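(* Let $\{(X_i,Y_i)\}_{i=1}^n$ be i.i.d. from $P$. Let $\ell(f;x,y)=:\ell(f)$ be a loss that is convex in $f$, and let the target function $f_0$ be the minimizer of $f\mapsto\mathbb{E}_P[\ell(f)]$. Assume: (A1) there is a measurable function $U(x,y)\ge0$ such that $|\ell(f;x,y)-\ell(g;x,y)|\le U(x,y)\cdot|f(x)-g(x)|$ for all $f,g\in\mathcal{F}_n$; (A2) for some $m>1$, with $m\wedge2=1+\kappa$, $\kappa\in(0,1]$: $U(X,Y)\in L^m(P)$ and $\|\mathbb{E}[U(X,Y)^{1+\kappa}\mid X]\|_{L^\infty}<\infty$; (A3) there are constants $0<c_1\le c_2<\infty$ with $c_1\|f-f_0\|_{L^2(P)}^2\le\mathbb{E}_P[\ell(f)]-\mathbb{E}_P[\ell(f_0)]\le c_2\|f-f_0\|_{L^2(P)}^2$ for all $f\in\mathcal{F}_n$. (B1) $\mathcal{F}_n\cup\{f_0\}$ is uniformly bounded by some $M>0$; (B2) there exist $D_{\mathcal{F}_n}\ge1$ and $\gamma\ge0$ such that, up to logarithmic factors, $\log N(x,\mathcal{F}_n,L^\infty)\le D_{\mathcal{F}_n}x^{-\gamma}$ for all $x>0$, i.e. there are constants $C_0>0$, $U_0\ge1$, $a_0\ge0$ with $\log N(x,\mathcal{F}_n,L^\infty)\le C_0D_{\mathcal{F}_n}x^{-\gamma}(\log_+(U_0/x))^{a_0}$ for all $x>0$; (B3) there is $s\in[0,1]$ and a constant $C_1$ such that for any $f_n^\ast\in\mathcal{F}_n$ and any subset $\mathcal{G}\subseteq\{f-f_n^\ast:f\in\mathcal{F}_n\}$,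 the envelope function $F_{\mathcal{G}}$ of $\mathcal{G}$ satisfies $\|F_{\mathcal{G}}\|_{L^\infty}\le C_1\sup_{f\in\mathcal{G}}\|f\|_{L^2(P)}^s$. Let $\tilde n=n/D_{\mathcal{F}_n}$ and $\hat f_n\in\arg\min_{f\in\mathcal{F}_n}\sum_{i=1}^n\ell(f;X_i,Y_i)$. Then there exist constants $C>0$ and $a\ge0$, not depending on $n$ or $D_{\mathcal{F}_n}$, such that $$\mathbb{E}\|\hat f_n-f_0\|_{L^2(P)}\le C(\log_+ n)^a\Bigl[\tilde n^{-\left(\frac{1}{2+\gamma}\wedge\frac{1}{2\gamma}\right)}+\tilde n^{-\left(\frac{2-s}{1-1/m}+s\gamma\right)^{-1}}+\inf_{f\in\mathcal{F}_n}\|f-f_0\|_{L^2(P)}\Bigr].$$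
   Context: $a\wedge b$ is the minimum, with $\frac1{2\gamma}=+\infty$ when $\gamma=0$; $\log_+(x)=1\vee\log x$. $\mathbb{E}_P[\ell(f)]=\mathbb{E}[\ell(f;X,Y)]$ with $(X,Y)\sim P$; $\|g\|_{L^2(P)}^2=\mathbb{E}[g(X)^2]$ with $X$ independent of the data. The envelope function of $\mathcal{G}$ is $F_{\mathcal{G}}(x)=\sup_{g\in\mathcal{G}}|g(x)|$. For a metric $d$, a set $K$ and $h>0$, $N(h,K,d)$ is the smallest cardinality of a subset $C\subseteq K$ such that every point of $K$ is within distance at most $h$ of a point of $C$; $L^\infty$ denotes the uniform norm metric. $\mathcal{F}_n$ and $D_{\mathcal{F}_n}$ may vary with $n$; the parameters $m,M,\gamma,s$ and the implied constants in the assumptions do not. *)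

theory Defs
  imports "HOL-Probability.Probability" "HOL-Library.Extended_Nat"
begin

definition log_plus :: "real \<Rightarrow> real"
  where "log_plus x = max 1 (ln x)"

text \<open>The power \<open>x\<^sup>s\<close> for \<open>x \<ge> 0\<close> with the convention \<open>0\<^sup>0 = 1\<close>;
  the library function \<open>powr\<close> has \<open>0 powr 0 = 0\<close>.\<close>

definition rpow :: "real \<Rightarrow> real \<Rightarrow> real"
  where "rpow x s = (if s = 0 then 1 else x powr s)"

text \<open>\<open>P\<close> is the law of the pair \<open>(X, Y)\<close>, whereas \<open>g\<close> is a function of the first component only.\<close>

definition L2_norm_fst :: "('x \<times> 'y) measure \<Rightarrow> ('x \<Rightarrow> real) \<Rightarrow> real"
  where "L2_norm_fst P g = sqrt (\<integral>z. (g (fst z))\<^sup>2 \<partial>P)"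

definition risk ::
  "('x \<times> 'y) measure \<Rightarrow> (('x \<Rightarrow> real) \<Rightarrow> 'x \<Rightarrow> 'y \<Rightarrow> real) \<Rightarrow> ('x \<Rightarrow> real) \<Rightarrow> real"
  where "risk P loss f = (\<integral>z. loss f (fst z) (snd z) \<partial>P)"

definition finite_risk ::
  "('x \<times> 'y) measure \<Rightarrow> (('x \<Rightarrow> real) \<Rightarrow> 'x \<Rightarrow> 'y \<Rightarrow> real) \<Rightarrow> ('x \<Rightarrow> real) \<Rightarrow> bool"
  where "finite_risk P loss f \<longleftrightarrow> integrable P (\<lambda>z. loss f (fst z) (snd z))"

text \<open>The uniform norm is taken over every point of \<open>S\<close> (no null sets are discarded). It is
  real-valued, so it is meaningful for functions that are bounded on the nonempty set \<open>S\<close>.\<close>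

definition unif_norm :: "'x set \<Rightarrow> ('x \<Rightarrow> real) \<Rightarrow> real"
  where "unif_norm S g = (SUP x\<in>S. \<bar>g x\<bar>)"

definition unif_dist :: "'x set \<Rightarrow> ('x \<Rightarrow> real) \<Rightarrow> ('x \<Rightarrow> real) \<Rightarrow> real"
  where "unif_dist S f g = unif_norm S (\<lambda>x. f x - g x)"

definition envelope :: "('x \<Rightarrow> real) set \<Rightarrow> 'x \<Rightarrow> real"
  where "envelope G x = (SUP g\<in>G. \<bar>g x\<bar>)"

text \<open>The covering number is \<open>\<infinity>\<close> when there is no finite \<open>h\<close>-net inside \<open>K\<close>.\<close>

definition covering_number :: "real \<Rightarrow> 'a set \<Rightarrow> ('a \<Rightarrow> 'a \<Rightarrow> real) \<Rightarrow> enat"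
  where "covering_number h K d =
    (INF C\<in>{C. finite C \<and> C \<subseteq> K \<and> (\<forall>p\<in>K. \<exists>c\<in>C. d p c \<le> h)}. enat (card C))"

definition log_covering_le :: "real \<Rightarrow> 'a set \<Rightarrow> ('a \<Rightarrow> 'a \<Rightarrow> real) \<Rightarrow> real \<Rightarrow> bool"
  where "log_covering_le h K d b \<longleftrightarrow>
    (\<exists>N. covering_number h K d = enat N \<and> ln (real N) \<le> b)"

text \<open>Convexity of the functional \<open>f \<mapsto> loss f x y\<close> on the space of measurable functions, spelled
  out because \<open>'x \<Rightarrow> real\<close> is not an instance of class \<open>real_vector\<close>, which \<open>convex_on\<close> needs.\<close>

definition convex_loss ::
  "'x measure \<Rightarrow> 'y measure \<Rightarrow> (('x \<Rightarrow> real) \<Rightarrow> 'x \<Rightarrow> 'y \<Rightarrow> real) \<Rightarrow> bool"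
  where "convex_loss MX MY loss \<longleftrightarrow>
    (\<forall>x\<in>space MX. \<forall>y\<in>space MY. \<forall>f\<in>borel_measurable MX. \<forall>g\<in>borel_measurable MX. \<forall>t\<in>{0..1}.
       loss (\<lambda>u. (1 - t) * f u + t * g u) x y \<le> (1 - t) * loss f x y + t * loss g x y)"

definition iid_sample ::
  "'w measure \<Rightarrow> 'x measure \<Rightarrow> 'y measure \<Rightarrow> ('x \<times> 'y) measure \<Rightarrow> nat
    \<Rightarrow> (nat \<Rightarrow> 'w \<Rightarrow> 'x) \<Rightarrow> (nat \<Rightarrow> 'w \<Rightarrow> 'y) \<Rightarrow> bool"
  where "iid_sample \<Omega> MX MY P n X Y \<longleftrightarrow>
    prob_space \<Omega> \<and>
    prob_space.indep_vars \<Omega> (\<lambda>_. MX \<Otimes>\<^sub>M MY) (\<lambda>i \<omega>. (X i \<omega>, Y i \<omega>)) {1..n} \<and>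
    (\<forall>i\<in>{1..n}. distr \<Omega> (MX \<Otimes>\<^sub>M MY) (\<lambda>\<omega>. (X i \<omega>, Y i \<omega>)) = P)"

text \<open>The exponent \<open>1/(2 + \<gamma>) \<and> 1/(2\<gamma>)\<close> with \<open>1/(2\<gamma>) = +\<infinity>\<close> at \<open>\<gamma> = 0\<close>; division by
  zero in HOL would give \<open>0\<close> instead.\<close>

definition entropy_exponent :: "real \<Rightarrow> real"
  where "entropy_exponent \<gamma> =
    (if \<gamma> = 0 then 1 / (2 + \<gamma>) else min (1 / (2 + \<gamma>)) (1 / (2 * \<gamma>)))"

end

theory Submission
  imports Defs
begin

text \<open>Put \<open>t = n / D\<close> and let \<open>e\<close> be the sum of the three terms of the asserted rate. Choose \<open>fs \<in> F\<close>
  with \<open>\<parallel>fs - f0\<parallel> \<le> e\<close>. Empirical minimality and the two-sided curvature condition bound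
  \<open>\<parallel>fhat - f0\<parallel>\<^sup>2\<close>, up to constants, by \<open>e\<^sup>2\<close> plus the deviation of the empirical average of
  \<open>\<ell>(fhat) - \<ell>(fs)\<close> from its mean. What has to be shown is therefore that the expected supremum of this
  deviation over the ball \<open>\<parallel>f - fs\<parallel> \<le> \<delta>\<close> of \<open>F\<close> is at most a power of \<open>log n\<close> times \<open>\<delta> * e\<close>, for
  every \<open>\<delta> \<ge> e\<close> (\<open>mean_sup_dev_le_local\<close>). Because that bound is linear in \<open>\<delta>\<close>, each of the
  \<open>O(log n)\<close> dyadic shells around \<open>fs\<close> contributes \<open>O(e)\<close> to the expected error, up to logarithms
  (\<open>peeling\<close>, \<open>empirical_minimizer_L2_error\<close>); bounds on first moments of suprema are enough.

  The bound over a ball is a chaining argument along uniform nets (\<open>mean_sup_dev_le_chaining\<close>). By the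
  envelope condition the ball has uniform radius of order \<open>\<delta>\<^sup>s\<close>, so the scales \<open>h\<close> run from there down to
  \<open>finest_scale \<gamma> t\<close>. A link at scale \<open>h\<close> is a difference of two losses that is at most \<open>3 * h * U\<close>, and
  with \<open>T = t * h\<^sup>\<gamma>\<close> the logarithm of the number of links is \<open>n / T\<close> up to logarithmic factors.
  The variable \<open>U\<close> has only \<open>m\<close> moments, so it is truncated, at a level \<open>K\<close> that depends on the
  scale: Bernstein's inequality costs \<open>h * K / T\<close>, the part cut off costs \<open>h * K powr (1 - m)\<close>, and both
  equal \<open>h * T powr (- (1 - 1/m))\<close> for \<open>K = T powr (1/m)\<close>. The variance contributes the same quantity if
  \<open>m < 2\<close>; if \<open>m \<ge> 2\<close>, conditioning on \<open>X\<close> turns the bounded conditional second moment of \<open>U\<close> into the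
  contribution \<open>min h \<delta> * T powr (- 1/2)\<close> (\<open>mean_sup_dev_le_heavy_tailed\<close>, \<open>mean_sup_dev_le_links\<close>).

  Both contributions are powers of \<open>h\<close>. If they increase with \<open>h\<close>, they are largest at \<open>h\<close> of order
  \<open>\<delta>\<^sup>s\<close> and at \<open>h = \<delta>\<close>, and there they are at most a constant times \<open>\<delta> * e\<close> once \<open>e\<close>
  dominates \<open>t\<close> to the powers \<open>- 1 / ((2 - s) / (1 - 1/m) + s * \<gamma>)\<close> and \<open>- 1 / (2 + \<gamma>)\<close>. If they
  decrease, they are largest at the finest scale, where \<open>T \<ge> 1\<close> bounds them by that scale itself; since
  the finest scale has to be at most \<open>e\<^sup>2\<close>, this is where the exponent \<open>1 / (2 * \<gamma>)\<close> comes from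
  (\<open>heavy_tail_scale_le\<close>, \<open>gaussian_scale_le\<close>). There are only \<open>O(log n)\<close> scales, so the sum over the
  chain is bounded by the number of scales times the largest term.\<close>

section \<open>Expected suprema of empirical deviations\<close>

lemma exp_le_quadratic:
  fixes x :: real
  assumes "\<bar>x\<bar> \<le> 1"
  shows "exp x \<le> 1 + x + x\<^sup>2"
proof (cases "0 \<le> x")
  case True
  then show ?thesis using exp_bound[of x] assms by simp
next
  case False
  define y where "y = - x"
  have y: "0 < y" "y \<le> 1" using False assms by (auto simp: y_def)
  have "exp x = 1 / exp y" by (simp add: y_def exp_minus field_simps)
  also have "\<dots> \<le> 1 / (1 + y)" using y by (intro divide_left_mono) (auto simp: exp_ge_add_one_self)
  also have "\<dots> \<le> 1 - y + y\<^sup>2"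
  proof -
    have "(1 - y + y\<^sup>2) * (1 + y) = 1 + y ^ 3" by (simp add: algebra_simps power2_eq_square power3_eq_cube)
    also have "\<dots> \<ge> 1" using y by simp
    finally show ?thesis using y by (simp add: field_simps)
  qed
  finally show ?thesis by (simp add: y_def)
qed

locale iid_draws = S: prob_space S + P: prob_space P
  for S :: "'w measure" and P :: "'z measure" +
  fixes n :: nat and Z :: "nat \<Rightarrow> 'w \<Rightarrow> 'z"
  assumes n_pos: "1 \<le> n"
    and indep: "S.indep_vars (\<lambda>_. P) Z {1..n}"
    and law: "\<And>i. i \<in> {1..n} \<Longrightarrow> distr S P (Z i) = P"
begin

definition dev :: "('z \<Rightarrow> real) \<Rightarrow> 'w \<Rightarrow> real"
  where "dev g \<omega> = (\<Sum>i=1..n. g (Z i \<omega>)) / real n - (\<integral>z. g z \<partial>P)"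

text \<open>A bound on the outer expectation of the supremum over \<open>G\<close>. The supremum over an uncountable class
  need not be measurable, so an integrable majorant takes its place; majorants can be added, and an
  upper bound on the final expectation needs nothing more.\<close>
definition mean_sup_dev_le :: "('z \<Rightarrow> real) set \<Rightarrow> real \<Rightarrow> bool"
  where "mean_sup_dev_le G b \<longleftrightarrow>
    (\<exists>W. integrable S W \<and> (\<integral>\<omega>. W \<omega> \<partial>S) \<le> b \<and> (\<forall>\<omega>\<in>space S. \<forall>g\<in>G. \<bar>dev g \<omega>\<bar> \<le> W \<omega>))"

lemma Z_measurable: "i \<in> {1..n} \<Longrightarrow> Z i \<in> measurable S P"
  using indep unfolding S.indep_vars_def by auto

lemma Z_space: "i \<in> {1..n} \<Longrightarrow> \<omega> \<in> space S \<Longrightarrow> Z i \<omega> \<in> space P"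
  using Z_measurable[of i] by (auto simp: measurable_def)

lemma
  fixes g :: "'z \<Rightarrow> real"
  assumes "i \<in> {1..n}" "integrable P g"
  shows integrable_Z: "integrable S (\<lambda>\<omega>. g (Z i \<omega>))"
    and integral_Z: "(\<integral>\<omega>. g (Z i \<omega>) \<partial>S) = (\<integral>z. g z \<partial>P)"
proof -
  have g: "g \<in> borel_measurable P" using assms by auto
  show "integrable S (\<lambda>\<omega>. g (Z i \<omega>))"
    using integrable_distr_eq[OF Z_measurable[OF assms(1)] g] law[OF assms(1)] assms(2) by simp
  show "(\<integral>\<omega>. g (Z i \<omega>) \<partial>S) = (\<integral>z. g z \<partial>P)"
    using integral_distr[OF Z_measurable[OF assms(1)] g] law[OF assms(1)] by simp
qed

lemma integrable_avg:
  fixes g :: "'z \<Rightarrow> real"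
  assumes "integrable P g"
  shows "integrable S (\<lambda>\<omega>. (\<Sum>i=1..n. g (Z i \<omega>)) / real n)"
    and "(\<integral>\<omega>. (\<Sum>i=1..n. g (Z i \<omega>)) / real n \<partial>S) = (\<integral>z. g z \<partial>P)"
proof -
  have i: "integrable S (\<lambda>\<omega>. g (Z i \<omega>))" if "i \<in> {1..n}" for i
    using integrable_Z[OF that assms] .
  show "integrable S (\<lambda>\<omega>. (\<Sum>i=1..n. g (Z i \<omega>)) / real n)"
    using i by (intro integrable_divide_zero Bochner_Integration.integrable_sum) auto
  have "(\<integral>\<omega>. (\<Sum>i=1..n. g (Z i \<omega>)) / real n \<partial>S) = (\<Sum>i=1..n. \<integral>\<omega>. g (Z i \<omega>) \<partial>S) / real n"
    using i by (simp add: Bochner_Integration.integral_sum)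
  also have "\<dots> = (\<integral>z. g z \<partial>P)"
    using n_pos integral_Z[OF _ assms] by simp
  finally show "(\<integral>\<omega>. (\<Sum>i=1..n. g (Z i \<omega>)) / real n \<partial>S) = (\<integral>z. g z \<partial>P)" .
qed

lemma dev_add:
  assumes "integrable P f" "integrable P g"
  shows "dev (\<lambda>z. f z + g z) \<omega> = dev f \<omega> + dev g \<omega>"
  using assms by (simp add: dev_def sum.distrib add_divide_distrib)

lemma dev_sum:
  assumes "finite I" "\<And>i. i \<in> I \<Longrightarrow> integrable P (f i)"
  shows "dev (\<lambda>z. \<Sum>i\<in>I. f i z) \<omega> = (\<Sum>i\<in>I. dev (f i) \<omega>)"
  using assms
proof (induction I rule: finite_induct)
  case empty
  then show ?case by (simp add: dev_def)
next
  case (insert i I)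
  then show ?case by (simp add: dev_add)
qed

lemma dev_abs_le:
  assumes "\<And>z. z \<in> space P \<Longrightarrow> \<bar>g z\<bar> \<le> u z" "integrable P u" "\<omega> \<in> space S"
  shows "\<bar>dev g \<omega>\<bar> \<le> (\<Sum>i=1..n. u (Z i \<omega>)) / real n + (\<integral>z. u z \<partial>P)"
proof -
  have "\<bar>\<Sum>i=1..n. g (Z i \<omega>)\<bar> \<le> (\<Sum>i=1..n. u (Z i \<omega>))"
    by (rule order_trans[OF sum_abs]) (intro sum_mono assms(1) Z_space assms(3))
  moreover have "\<bar>\<integral>z. g z \<partial>P\<bar> \<le> (\<integral>z. u z \<partial>P)"
  proof (cases "integrable P g")
    case True
    have "\<bar>\<integral>z. g z \<partial>P\<bar> \<le> (\<integral>z. \<bar>g z\<bar> \<partial>P)" by simp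
    also have "\<dots> \<le> (\<integral>z. u z \<partial>P)" using True assms by (intro integral_mono) auto
    finally show ?thesis .
  next
    case False
    have "0 \<le> u z" if "z \<in> space P" for z using assms(1)[OF that] by linarith
    then have "0 \<le> (\<integral>z. u z \<partial>P)" by (intro integral_nonneg_AE AE_I2)
    with False show ?thesis by (simp add: not_integrable_integral_eq)
  qed
  moreover have "\<bar>dev g \<omega>\<bar> \<le> \<bar>\<Sum>i=1..n. g (Z i \<omega>)\<bar> / real n + \<bar>\<integral>z. g z \<partial>P\<bar>"
    unfolding dev_def using abs_triangle_ineq4[of "(\<Sum>i=1..n. g (Z i \<omega>)) / real n"] by simp
  ultimately show ?thesis using divide_right_mono[of _ _ "real n"] by fastforce
qed

text \<open>The empirical average and the mean are estimated separately, without any gain from averaging. This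
  is good enough for the two contributions that are small in themselves: the tails removed by
  truncation, and the increments below the finest scale of the chain.\<close>
lemma mean_sup_dev_le_envelope:
  assumes "integrable P u" "\<And>g z. g \<in> G \<Longrightarrow> z \<in> space P \<Longrightarrow> \<bar>g z\<bar> \<le> u z"
  shows "mean_sup_dev_le G (2 * (\<integral>z. u z \<partial>P))"
  unfolding mean_sup_dev_le_def
proof (intro exI conjI ballI)
  let ?W = "\<lambda>\<omega>. (\<Sum>i=1..n. u (Z i \<omega>)) / real n + (\<integral>z. u z \<partial>P)"
  show "integrable S ?W" using integrable_avg(1)[OF assms(1)] by simp
  have "(\<integral>\<omega>. ?W \<omega> \<partial>S) = (\<integral>\<omega>. (\<Sum>i=1..n. u (Z i \<omega>)) / real n \<partial>S) + (\<integral>\<omega>. (\<integral>z. u z \<partial>P) \<partial>S)"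
    by (rule Bochner_Integration.integral_add[OF integrable_avg(1)[OF assms(1)]]) simp
  also have "\<dots> = 2 * (\<integral>z. u z \<partial>P)" using integrable_avg(2)[OF assms(1)] by (simp add: S.prob_space)
  finally show "(\<integral>\<omega>. ?W \<omega> \<partial>S) \<le> 2 * (\<integral>z. u z \<partial>P)" by simp
  show "\<bar>dev g \<omega>\<bar> \<le> ?W \<omega>" if "\<omega> \<in> space S" "g \<in> G" for \<omega> g
    using dev_abs_le[of g u] assms that by auto
qed

text \<open>Deviations are linear in the function, so a class whose members decompose into summands is
  controlled by the classes of summands.\<close>
lemma mean_sup_dev_le_sum:
  assumes "finite I" "\<And>i. i \<in> I \<Longrightarrow> mean_sup_dev_le (G i) (b i)"
    and "\<And>g. g \<in> H \<Longrightarrow> \<exists>f. (\<forall>i\<in>I. f i \<in> G i \<and> integrable P (f i)) \<and> g = (\<lambda>z. \<Sum>i\<in>I. f i z)"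
  shows "mean_sup_dev_le H (\<Sum>i\<in>I. b i)"
proof -
  have "\<forall>i\<in>I. \<exists>W. integrable S W \<and> (\<integral>\<omega>. W \<omega> \<partial>S) \<le> b i \<and> (\<forall>\<omega>\<in>space S. \<forall>g\<in>G i. \<bar>dev g \<omega>\<bar> \<le> W \<omega>)"
    using assms(2) unfolding mean_sup_dev_le_def by auto
  then obtain W where W: "\<And>i. i \<in> I \<Longrightarrow> integrable S (W i)" "\<And>i. i \<in> I \<Longrightarrow> (\<integral>\<omega>. W i \<omega> \<partial>S) \<le> b i"
    "\<And>i \<omega> g. i \<in> I \<Longrightarrow> \<omega> \<in> space S \<Longrightarrow> g \<in> G i \<Longrightarrow> \<bar>dev g \<omega>\<bar> \<le> W i \<omega>"
    unfolding bchoice_iff by auto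
  show ?thesis unfolding mean_sup_dev_le_def
  proof (intro exI conjI ballI)
    show "integrable S (\<lambda>\<omega>. \<Sum>i\<in>I. W i \<omega>)" using W by auto
    show "(\<integral>\<omega>. (\<Sum>i\<in>I. W i \<omega>) \<partial>S) \<le> sum b I"
      using W by (subst Bochner_Integration.integral_sum) (auto intro: sum_mono)
    fix \<omega> g assume "\<omega> \<in> space S" "g \<in> H"
    then obtain f where f: "\<And>i. i \<in> I \<Longrightarrow> f i \<in> G i" "\<And>i. i \<in> I \<Longrightarrow> integrable P (f i)" "g = (\<lambda>z. \<Sum>i\<in>I. f i z)"
      using assms(3) by metis
    have "dev g \<omega> = (\<Sum>i\<in>I. dev (f i) \<omega>)" using dev_sum[OF assms(1)] f by auto
    also have "\<bar>\<dots>\<bar> \<le> (\<Sum>i\<in>I. W i \<omega>)"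
      by (rule order_trans[OF sum_abs]) (intro sum_mono W(3) f \<open>\<omega> \<in> space S\<close>)
    finally show "\<bar>dev g \<omega>\<bar> \<le> (\<Sum>i\<in>I. W i \<omega>)" .
  qed
qed

lemma mean_sup_dev_le_mono:
  "mean_sup_dev_le G b \<Longrightarrow> b \<le> b' \<Longrightarrow> mean_sup_dev_le G b'"
  unfolding mean_sup_dev_le_def by (meson order_trans)

text \<open>By independence the moment generating function is an \<open>n\<close>-fold power. Each factor is at most
  \<open>1 + t\<^sup>2 * V\<close>, because the linear term of \<open>exp_le_quadratic\<close> vanishes after centring.\<close>
lemma dev_mgf:
  fixes g :: "'z \<Rightarrow> real"
  assumes g: "g \<in> borel_measurable P" and B: "\<And>z. z \<in> space P \<Longrightarrow> \<bar>g z\<bar> \<le> B"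
    and V: "(\<integral>z. (g z)\<^sup>2 \<partial>P) \<le> V" and t: "\<bar>t\<bar> * (2 * B) \<le> 1"
  shows "integrable S (\<lambda>\<omega>. exp (t * (real n * dev g \<omega>)))"
    and "(\<integral>\<omega>. exp (t * (real n * dev g \<omega>)) \<partial>S) \<le> exp (real n * t\<^sup>2 * V)"
proof -
  define e where "e = (\<integral>z. g z \<partial>P)"
  define f where "f z = exp (t * (g z - e))" for z
  have gi: "integrable P g" "integrable P (\<lambda>z. (g z)\<^sup>2)"
  proof -
    show "integrable P g" by (rule P.integrable_const_bound[where B=B]) (use g B in auto)
    have "\<bar>g z\<bar>\<^sup>2 \<le> B\<^sup>2" if "z \<in> space P" for z by (rule power_mono[OF B[OF that]]) simp
    then show "integrable P (\<lambda>z. (g z)\<^sup>2)"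
      by (intro P.integrable_const_bound[where B="B\<^sup>2"]) (use g in auto)
  qed
  have eB: "\<bar>e\<bar> \<le> B"
  proof -
    have "\<bar>e\<bar> \<le> (\<integral>z. \<bar>g z\<bar> \<partial>P)" unfolding e_def by simp
    also have "\<dots> \<le> (\<integral>z. B \<partial>P)" using gi B by (intro integral_mono) auto
    finally show ?thesis by (simp add: P.prob_space)
  qed
  have small: "\<bar>t * (g z - e)\<bar> \<le> 1" if "z \<in> space P" for z
  proof -
    have "\<bar>g z - e\<bar> \<le> 2 * B" using B[OF that] eB by linarith
    then have "\<bar>t\<bar> * \<bar>g z - e\<bar> \<le> \<bar>t\<bar> * (2 * B)" by (intro mult_left_mono) auto
    then show ?thesis using t by (simp add: abs_mult)
  qed
  have fm: "f \<in> borel_measurable P" unfolding f_def using g by measurable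
  have fi: "integrable P f"
    by (rule P.integrable_const_bound[where B="exp 1"])
       (use small fm in \<open>auto simp: f_def abs_le_iff\<close>)
  have quad: "integrable P (\<lambda>z. 1 + t * (g z - e) + (t * (g z - e))\<^sup>2)"
    by (simp only: power_mult_distrib power2_diff) (use gi in simp)
  have "(\<integral>z. f z \<partial>P) \<le> (\<integral>z. 1 + t * (g z - e) + (t * (g z - e))\<^sup>2 \<partial>P)"
    by (rule integral_mono[OF fi quad]) (use small exp_le_quadratic in \<open>auto simp: f_def\<close>)
  also have "\<dots> = (\<integral>z. (1 - t * e + t\<^sup>2 * e\<^sup>2) + (t - 2 * t\<^sup>2 * e) * g z + t\<^sup>2 * (g z)\<^sup>2 \<partial>P)"
    by (rule Bochner_Integration.integral_cong) (auto simp: power2_eq_square algebra_simps)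
  also have "\<dots> = (1 - t * e + t\<^sup>2 * e\<^sup>2) + (t - 2 * t\<^sup>2 * e) * e + t\<^sup>2 * (\<integral>z. (g z)\<^sup>2 \<partial>P)"
    using gi by (simp add: P.prob_space e_def)
  also have "\<dots> = 1 + t\<^sup>2 * ((\<integral>z. (g z)\<^sup>2 \<partial>P) - e\<^sup>2)"
    by (simp add: power2_eq_square algebra_simps)
  also have "\<dots> \<le> 1 + t\<^sup>2 * V"
    using V by (intro add_left_mono mult_left_mono) (auto intro: order_trans[rotated])
  also have "\<dots> \<le> exp (t\<^sup>2 * V)" by (simp add: exp_ge_add_one_self)
  finally have fV: "(\<integral>z. f z \<partial>P) \<le> exp (t\<^sup>2 * V)" .
  have eq: "exp (t * (real n * dev g \<omega>)) = (\<Prod>i=1..n. f (Z i \<omega>))" for \<omega>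
  proof -
    have "t * (real n * dev g \<omega>) = (\<Sum>i=1..n. t * (g (Z i \<omega>) - e))"
      using n_pos by (simp add: dev_def e_def sum_distrib_left[symmetric] sum_subtractf field_simps)
    then show ?thesis by (simp add: exp_sum f_def)
  qed
  have ind: "S.indep_vars (\<lambda>_. borel) (\<lambda>i \<omega>. f (Z i \<omega>)) {1..n}"
    using S.indep_vars_compose2[OF indep, of "\<lambda>_. f"] fm by simp
  have fin: "\<And>i. i \<in> {1..n} \<Longrightarrow> integrable S (\<lambda>\<omega>. f (Z i \<omega>))"
    using integrable_Z fi by blast
  show "integrable S (\<lambda>\<omega>. exp (t * (real n * dev g \<omega>)))"
    unfolding eq using S.indep_vars_integrable[OF _ ind fin] by simp
  have "(\<integral>\<omega>. exp (t * (real n * dev g \<omega>)) \<partial>S) = (\<Prod>i=1..n. \<integral>\<omega>. f (Z i \<omega>) \<partial>S)"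
    unfolding eq using S.indep_vars_lebesgue_integral[OF _ ind fin] by simp
  also have "\<dots> = (\<integral>z. f z \<partial>P) ^ n" using integral_Z[OF _ fi] by simp
  also have "\<dots> \<le> exp (t\<^sup>2 * V) ^ n"
    by (intro power_mono fV Bochner_Integration.integral_nonneg) (simp add: f_def)
  also have "\<dots> = exp (real n * t\<^sup>2 * V)" by (simp add: exp_of_nat_mult[symmetric] algebra_simps)
  finally show "(\<integral>\<omega>. exp (t * (real n * dev g \<omega>)) \<partial>S) \<le> exp (real n * t\<^sup>2 * V)" .
qed

text \<open>Bernstein's maximal inequality in expectation. For every \<open>a\<close> one has
  \<open>t * x \<le> a + exp (t * x - a)\<close>; summing the exponentials over the class and over both signs gives a
  majorant of the maximum whose expectation is explicit, so the usual passage through the logarithm of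
  an expectation is avoided.\<close>
lemma mean_sup_dev_le_bounded_class:
  assumes G: "finite G" "G \<noteq> {}" "\<And>g. g \<in> G \<Longrightarrow> g \<in> borel_measurable P"
    and B: "0 < B" "\<And>g z. g \<in> G \<Longrightarrow> z \<in> space P \<Longrightarrow> \<bar>g z\<bar> \<le> B"
    and V: "0 < V" "\<And>g. g \<in> G \<Longrightarrow> (\<integral>z. (g z)\<^sup>2 \<partial>P) \<le> V"
    and L: "1 + ln (2 * real (card G)) \<le> L"
  shows "mean_sup_dev_le G (2 * sqrt (V * (L / real n)) + 2 * B * (L / real n))"
proof -
  define N where "N = real (card G)"
  have N: "1 \<le> N" using G by (simp add: N_def Suc_leI card_gt_0_iff)
  have L1: "1 \<le> L" using L N ln_ge_zero[of "2*N"] unfolding N_def by linarith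
  have n0: "0 < real n" using n_pos by simp
  \<comment> \<open>The first argument balances \<open>L / (n * t)\<close> against \<open>t * V\<close>; the second one keeps the exponents
    within the range \<open>[-1, 1]\<close> of the quadratic bound.\<close>
  define t where "t = min (sqrt (L / (real n * V))) (1 / (2 * B))"
  have t0: "0 < t" unfolding t_def using L1 V B n0 by simp
  have tB: "\<bar>t\<bar> * (2 * B) \<le> 1" "\<bar>-t\<bar> * (2 * B) \<le> 1"
    using B(1) t0 by (auto simp: t_def min_def field_simps)
  \<comment> \<open>With this \<open>a\<close> the expected sum of the exponentials, weighted by \<open>exp (- a)\<close>, is at most \<open>1\<close>.\<close>
  define a where "a = ln (2 * N) + real n * t\<^sup>2 * V"
  define E where "E g \<omega> = exp (t * (real n * dev g \<omega>)) + exp (- t * (real n * dev g \<omega>))" for g \<omega>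
  define W where "W \<omega> = (a + exp (- a) * (\<Sum>g\<in>G. E g \<omega>)) / (t * real n)" for \<omega>
  have E: "integrable S (E g)" "(\<integral>\<omega>. E g \<omega> \<partial>S) \<le> 2 * exp (real n * t\<^sup>2 * V)" if "g \<in> G" for g
  proof -
    note m1 = dev_mgf[OF G(3)[OF that] B(2)[OF that] V(2)[OF that] tB(1)]
    note m2 = dev_mgf[OF G(3)[OF that] B(2)[OF that] V(2)[OF that] tB(2)]
    show "integrable S (E g)" unfolding E_def using m1 m2 by (intro Bochner_Integration.integrable_add) auto
    have "(\<integral>\<omega>. E g \<omega> \<partial>S) = (\<integral>\<omega>. exp (t * (real n * dev g \<omega>)) \<partial>S) + (\<integral>\<omega>. exp (- t * (real n * dev g \<omega>)) \<partial>S)"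
      unfolding E_def using m1 m2 by (intro Bochner_Integration.integral_add) auto
    then show "(\<integral>\<omega>. E g \<omega> \<partial>S) \<le> 2 * exp (real n * t\<^sup>2 * V)" using m1(2) m2(2) by simp
  qed
  have Ei: "integrable S (\<lambda>\<omega>. exp (- a) * (\<Sum>g\<in>G. E g \<omega>))" using E by auto
  have "(\<integral>\<omega>. W \<omega> \<partial>S) = (a + exp (- a) * (\<Sum>g\<in>G. \<integral>\<omega>. E g \<omega> \<partial>S)) / (t * real n)"
    unfolding W_def using E Ei by (simp add: S.prob_space Bochner_Integration.integral_sum)
  also have "\<dots> \<le> (a + exp (- a) * (\<Sum>g\<in>G. 2 * exp (real n * t\<^sup>2 * V))) / (t * real n)"
    using E t0 by (intro divide_right_mono add_left_mono mult_left_mono sum_mono) auto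
  also have "exp (- a) * (\<Sum>g\<in>G. 2 * exp (real n * t\<^sup>2 * V)) = 1"
    using N by (simp add: a_def exp_diff exp_minus exp_add N_def[symmetric] field_simps)
  also have "(a + 1) / (t * real n) \<le> (L + real n * t\<^sup>2 * V) / (t * real n)"
    using L t0 by (intro divide_right_mono) (auto simp: a_def N_def)
  also have "\<dots> = (L / real n) * (1 / t) + t * V"
    using t0 n0 by (simp add: field_simps power2_eq_square)
  also have "\<dots> \<le> (L / real n) * (sqrt (real n * V / L) + 2 * B) + sqrt (L / (real n * V)) * V"
  proof (intro add_mono mult_left_mono mult_right_mono)
    have "1 / t \<le> 1 / sqrt (L / (real n * V)) + 2 * B"
      using B(1) V(1) L1 n0 unfolding t_def min_def by auto
    then show "1 / t \<le> sqrt (real n * V / L) + 2 * B" by (simp add: real_sqrt_divide)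
  qed (use L1 V n0 in \<open>auto simp: t_def\<close>)
  also have "\<dots> = 2 * sqrt (V * (L / real n)) + 2 * B * (L / real n)"
  proof -
    have "(L / real n) * sqrt (real n * V / L) = sqrt ((L / real n)\<^sup>2 * (real n * V / L))"
      using L1 n0 by (subst real_sqrt_mult) simp
    also have "(L / real n)\<^sup>2 * (real n * V / L) = V * (L / real n)"
      using L1 n0 by (simp add: field_simps power2_eq_square)
    finally have 1: "(L / real n) * sqrt (real n * V / L) = sqrt (V * (L / real n))" .
    have "sqrt (L / (real n * V)) * V = sqrt ((L / (real n * V)) * V\<^sup>2)"
      using V(1) by (subst real_sqrt_mult) simp
    also have "(L / (real n * V)) * V\<^sup>2 = V * (L / real n)"
      using V n0 by (simp add: field_simps power2_eq_square)
    finally show ?thesis using 1 by (simp add: distrib_left)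
  qed
  finally have Wb: "(\<integral>\<omega>. W \<omega> \<partial>S) \<le> 2 * sqrt (V * (L / real n)) + 2 * B * (L / real n)" .
  have Wi: "integrable S W" unfolding W_def using Ei by simp
  have "\<bar>dev g \<omega>\<bar> \<le> W \<omega>" if "g \<in> G" for g \<omega>
  proof -
    have "t * (real n * \<bar>dev g \<omega>\<bar>) - a \<le> exp (t * (real n * \<bar>dev g \<omega>\<bar>) - a)"
      using exp_ge_add_one_self[of "t * (real n * \<bar>dev g \<omega>\<bar>) - a"] by linarith
    also have "\<dots> = exp (- a) * exp (t * (real n * \<bar>dev g \<omega>\<bar>))" by (simp add: exp_diff exp_minus field_simps)
    also have "\<dots> \<le> exp (- a) * E g \<omega>"
      by (intro mult_left_mono) (auto simp: E_def abs_if)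
    also have "\<dots> \<le> exp (- a) * (\<Sum>g\<in>G. E g \<omega>)"
      by (intro mult_left_mono member_le_sum that G) (auto simp: E_def)
    finally show ?thesis unfolding W_def using t0 n0 by (simp add: field_simps)
  qed
  with Wb Wi show ?thesis unfolding mean_sup_dev_le_def by blast
qed

end

section \<open>Truncation of heavy tails\<close>

lemma integrable_powr_lower:
  fixes u :: "'z \<Rightarrow> real"
  assumes "prob_space P" "u \<in> borel_measurable P" "\<And>z. z \<in> space P \<Longrightarrow> 0 \<le> u z"
    and "integrable P (\<lambda>z. u z powr m)" "0 \<le> p" "p \<le> m"
  shows "integrable P (\<lambda>z. u z powr p)"
proof -
  interpret prob_space P by fact
  have le: "x powr p \<le> 1 + x powr m" if "0 \<le> x" for x :: real
  proof (cases "x \<le> 1")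
    case True
    then have "x powr p \<le> 1 powr p" using that assms by (intro powr_mono2) auto
    then show ?thesis by simp (smt (verit) powr_ge_zero)
  next
    case False
    then show ?thesis using powr_mono[of p m x] assms(6) by linarith
  qed
  show ?thesis
    by (rule Bochner_Integration.integrable_bound[where f = "\<lambda>z. 1 + u z powr m"]) (use assms le in auto)
qed

context iid_draws begin

lemma mean_sup_dev_le_add:
  assumes "mean_sup_dev_le G1 b1" "mean_sup_dev_le G2 b2"
    and "\<And>g. g \<in> H \<Longrightarrow> \<exists>f1\<in>G1. \<exists>f2\<in>G2. integrable P f1 \<and> integrable P f2 \<and> g = (\<lambda>z. f1 z + f2 z)"
  shows "mean_sup_dev_le H (b1 + b2)"
proof -
  have "mean_sup_dev_le H (\<Sum>i\<in>(UNIV::bool set). if i then b1 else b2)"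
  proof (rule mean_sup_dev_le_sum[where G = "\<lambda>i. if i then G1 else G2"])
    fix g assume "g \<in> H"
    then obtain f1 f2 where "f1 \<in> G1" "f2 \<in> G2" "integrable P f1" "integrable P f2" "g = (\<lambda>z. f1 z + f2 z)"
      using assms(3) by blast
    then show "\<exists>f. (\<forall>i\<in>UNIV. f i \<in> (if i then G1 else G2) \<and> integrable P (f i)) \<and> g = (\<lambda>z. \<Sum>i\<in>UNIV. f i z)"
      by (intro exI[of _ "\<lambda>i. if i then f1 else f2"]) (auto simp: UNIV_bool add.commute)
  qed (use assms in auto)
  then show ?thesis by (simp add: UNIV_bool add.commute)
qed

text \<open>Where \<open>u \<le> K\<close> the functions are bounded by \<open>r * K\<close> and Bernstein applies. Where \<open>u > K\<close> they are
  dominated by \<open>r * u \<le> r * K powr (1 - m) * u powr m\<close>, a single integrable function for the whole class.\<close>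
lemma mean_sup_dev_le_truncated:
  assumes G: "finite G" "G \<noteq> {}" "\<And>g. g \<in> G \<Longrightarrow> g \<in> borel_measurable P"
    and u: "u \<in> borel_measurable P" "\<And>z. z \<in> space P \<Longrightarrow> 0 \<le> u z"
      "integrable P (\<lambda>z. u z powr m)" "(\<integral>z. u z powr m \<partial>P) \<le> \<mu>" "1 < m"
    and r: "0 < r" "\<And>g z. g \<in> G \<Longrightarrow> z \<in> space P \<Longrightarrow> \<bar>g z\<bar> \<le> r * u z"
    and K: "0 < K"
    and V: "0 < V" "\<And>g. g \<in> G \<Longrightarrow> (\<integral>z. (if u z \<le> K then g z else 0)\<^sup>2 \<partial>P) \<le> V"
    and L: "1 + ln (2 * real (card G)) \<le> L"
  shows "mean_sup_dev_le G (2 * sqrt (V * (L / real n)) + 2 * (r * K) * (L / real n) + 2 * (r * (K powr (1 - m) * \<mu>)))"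
proof -
  define lo where "lo g z = (if u z \<le> K then g z else 0)" for g :: "'z \<Rightarrow> real" and z
  define hi where "hi g z = (if u z \<le> K then 0 else g z)" for g :: "'z \<Rightarrow> real" and z
  have rK: "\<bar>lo g z\<bar> \<le> r * K" if "g \<in> G" "z \<in> space P" for g z
    using r(2)[OF that] r(1) K mult_left_mono[of "u z" K r] by (auto simp: lo_def intro: order_trans)
  have lo_m: "lo g \<in> borel_measurable P" "hi g \<in> borel_measurable P" if "g \<in> G" for g
    unfolding lo_def[abs_def] hi_def[abs_def] using G(3)[OF that] u(1) by measurable
  have card: "card (lo ` G) \<le> card G" "0 < card (lo ` G)"
    using G by (auto simp: card_image_le card_gt_0_iff)
  have A: "mean_sup_dev_le (lo ` G) (2 * sqrt (V * (L / real n)) + 2 * (r * K) * (L / real n))"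
  proof (rule mean_sup_dev_le_bounded_class)
    have "ln (2 * real (card (lo ` G))) \<le> ln (2 * real (card G))" using card by simp
    then show "1 + ln (2 * real (card (lo ` G))) \<le> L" using L by linarith
  qed (use G r K V rK lo_m in \<open>auto simp: lo_def[abs_def]\<close>)
  have ui: "integrable P u"
    using integrable_powr_lower[OF P.prob_space_axioms u(1,2,3), of 1] u(2,5)
    by (subst Bochner_Integration.integrable_cong[where g = "\<lambda>z. u z powr 1"]) auto
  define t where "t z = (if u z \<le> K then 0 else r * u z)" for z
  have t_le: "t z \<le> r * (K powr (1 - m) * u z powr m)" if "z \<in> space P" for z
  proof (cases "u z \<le> K")
    case True
    then show ?thesis using r(1) by (simp add: t_def)
  next
    case False
    have "u z = u z powr (1 - m) * u z powr m" using False K by (simp flip: powr_add)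
    also have "\<dots> \<le> K powr (1 - m) * u z powr m"
      using False K u(5) by (intro mult_right_mono powr_mono2') auto
    finally show ?thesis using False r(1) by (simp add: t_def)
  qed
  have ti: "integrable P t"
  proof (rule Bochner_Integration.integrable_bound[where f = "\<lambda>z. r * u z"])
    show "t \<in> borel_measurable P" unfolding t_def[abs_def] using u(1) by measurable
  qed (use ui r(1) in \<open>auto simp: t_def\<close>)
  have "(\<integral>z. t z \<partial>P) \<le> (\<integral>z. r * (K powr (1 - m) * u z powr m) \<partial>P)"
    by (rule integral_mono[OF ti]) (use u t_le in auto)
  also have "\<dots> = r * (K powr (1 - m) * (\<integral>z. u z powr m \<partial>P))" by simp
  also have "\<dots> \<le> r * (K powr (1 - m) * \<mu>)" using r(1) u(4) by (intro mult_left_mono) auto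
  finally have tb: "(\<integral>z. t z \<partial>P) \<le> r * (K powr (1 - m) * \<mu>)" .
  have "mean_sup_dev_le (hi ` G) (2 * (\<integral>z. t z \<partial>P))"
    by (rule mean_sup_dev_le_envelope[OF ti]) (use r in \<open>auto simp: hi_def t_def\<close>)
  then have B: "mean_sup_dev_le (hi ` G) (2 * (r * (K powr (1 - m) * \<mu>)))"
    by (rule mean_sup_dev_le_mono) (use tb in simp)
  show ?thesis
  proof (rule mean_sup_dev_le_add[OF A B])
    fix g assume g: "g \<in> G"
    have "integrable P (lo g)"
      by (rule P.integrable_const_bound[where B = "r * K"]) (use rK lo_m g in auto)
    moreover have "integrable P (hi g)"
    proof (rule Bochner_Integration.integrable_bound[where f = "\<lambda>z. r * u z"])
      show "hi g \<in> borel_measurable P" using lo_m g by blast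
    qed (use ui r g in \<open>fastforce simp: hi_def\<close>)+
    moreover have "g = (\<lambda>z. lo g z + hi g z)" by (auto simp: lo_def hi_def)
    ultimately show "\<exists>f1\<in>lo ` G. \<exists>f2\<in>hi ` G. integrable P f1 \<and> integrable P f2 \<and> g = (\<lambda>z. f1 z + f2 z)"
      using g by blast
  qed
qed

text \<open>The truncation level \<open>T powr (1 / m)\<close> equates the Bernstein term \<open>r * K / T\<close> with the tail term
  \<open>r * K powr (1 - m)\<close>. If \<open>m < 2\<close> the truncated second moment is at most \<open>r\<^sup>2 * K powr (2 - m) * \<tau>\<close>,
  and its square root leads to the same power of \<open>T\<close>; only if \<open>m \<ge> 2\<close> does the variance bound \<open>\<tau> * v\<^sup>2\<close>
  produce a term of its own.\<close>
lemma mean_sup_dev_le_heavy_tailed: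
  assumes G: "finite G" "G \<noteq> {}" "\<And>g. g \<in> G \<Longrightarrow> g \<in> borel_measurable P"
    and u: "u \<in> borel_measurable P" "\<And>z. z \<in> space P \<Longrightarrow> 0 \<le> u z"
      "integrable P (\<lambda>z. u z powr m)" "(\<integral>z. u z powr m \<partial>P) \<le> \<tau>" "1 < m" "1 \<le> \<tau>"
    and r: "0 < r" "\<And>g z. g \<in> G \<Longrightarrow> z \<in> space P \<Longrightarrow> \<bar>g z\<bar> \<le> r * u z"
    and v: "0 < v" "\<And>g. g \<in> G \<Longrightarrow> 2 \<le> m \<Longrightarrow> (\<integral>z. (g z)\<^sup>2 \<partial>P) \<le> \<tau> * v\<^sup>2"
    and L: "1 + ln (2 * real (card G)) \<le> L" "L / real n \<le> \<Lambda> / T" "0 < T" "1 \<le> \<Lambda>"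
  shows "mean_sup_dev_le G (6 * \<tau> * \<Lambda> * (r * T powr (- (1 - 1 / m)) + v * T powr (- (1 / 2))))"
proof -
  define q where "q = 1 - 1 / m"
  define K where "K = T powr (1 / m)"
  have K: "0 < K" using L by (simp add: K_def)
  have K_T: "K / T = T powr - q" "K powr (1 - m) = T powr - q" "sqrt (K powr (2 - m) / T) = T powr - q"
  proof -
    have "K / T = T powr (1 / m - 1)" using L unfolding K_def by (simp add: powr_diff)
    then show "K / T = T powr - q" by (simp add: q_def)
    show "K powr (1 - m) = T powr - q" using u(5) by (simp add: K_def q_def powr_powr diff_divide_distrib)
    have "K powr (2 - m) / T = T powr ((2 - m) / m) * T powr (- 1)"
      using L unfolding K_def by (simp add: powr_powr powr_minus_divide)
    also have "\<dots> = T powr ((2 - m) / m - 1)" by (simp only: powr_add[symmetric]) simp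
    also have "(2 - m) / m - 1 = 2 * (- q)" using u(5) by (simp add: q_def field_simps)
    also have "T powr (2 * (- q)) = (T powr (- q))\<^sup>2"
      using powr_add[of T "-q" "-q"] by (simp add: power2_eq_square)
    finally show "sqrt (K powr (2 - m) / T) = T powr - q" by simp
  qed
  have int_pow: "integrable P (\<lambda>z. (u z)\<^sup>2)" if "2 \<le> m"
    using integrable_powr_lower[OF P.prob_space_axioms u(1,2,3), of 2] that u(2)
    by (subst Bochner_Integration.integrable_cong[where g = "\<lambda>z. u z powr 2"]) auto
  have g2: "(g z)\<^sup>2 \<le> r\<^sup>2 * (u z)\<^sup>2" if "g \<in> G" "z \<in> space P" for g z
    using power_mono[OF r(2)[OF that], of 2] by (simp add: power_mult_distrib)
  have A: "mean_sup_dev_le G (2 * sqrt (V * (L / real n)) + 2 * (r * K) * (L / real n) + 2 * (r * (K powr (1 - m) * \<tau>)))"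
    if "0 < V" "\<And>g. g \<in> G \<Longrightarrow> (\<integral>z. (if u z \<le> K then g z else 0)\<^sup>2 \<partial>P) \<le> V" for V
    by (rule mean_sup_dev_le_truncated[where u = u and m = m]) (use G u r K that L in auto)
  have rest: "2 * (r * K) * (L / real n) + 2 * (r * (K powr (1 - m) * \<tau>)) \<le> 4 * \<tau> * \<Lambda> * (r * T powr - q)"
  proof -
    have "2 * (r * K) * (L / real n) \<le> 2 * (r * K) * (\<Lambda> / T)"
      using r(1) K L by (intro mult_left_mono) auto
    also have "\<dots> = 2 * \<Lambda> * (r * (K / T))" by simp
    also have "\<dots> = 2 * (1 * \<Lambda>) * (r * T powr - q)" using K_T by simp
    also have "\<dots> \<le> 2 * (\<tau> * \<Lambda>) * (r * T powr - q)"
      using r(1) u L by (intro mult_right_mono mult_left_mono) auto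
    finally have 1: "2 * (r * K) * (L / real n) \<le> 2 * (\<tau> * \<Lambda>) * (r * T powr - q)" .
    have "2 * (r * (K powr (1 - m) * \<tau>)) = 2 * (\<tau> * 1) * (r * T powr - q)" using K_T by simp
    also have "\<dots> \<le> 2 * (\<tau> * \<Lambda>) * (r * T powr - q)"
      using r(1) u L by (intro mult_right_mono mult_left_mono) auto
    finally show ?thesis using 1 by simp
  qed
  have "1 \<le> \<tau> * \<Lambda>" using u(6) L(4) mult_mono[of 1 \<tau> 1 \<Lambda>] by simp
  then have sq: "sqrt (\<tau> * \<Lambda>) \<le> \<tau> * \<Lambda>"
    by (intro real_le_lsqrt self_le_power) auto
  show ?thesis
  proof (cases "2 \<le> m")
    case True
    have base: "mean_sup_dev_le G (2 * sqrt (\<tau> * v\<^sup>2 * (L / real n)) + 2 * (r * K) * (L / real n) + 2 * (r * (K powr (1 - m) * \<tau>)))"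
    proof (rule A)
      fix g assume g: "g \<in> G"
      have gi: "integrable P (\<lambda>z. (g z)\<^sup>2)"
        by (rule Bochner_Integration.integrable_bound[where f = "\<lambda>z. r\<^sup>2 * (u z)\<^sup>2"])
           (use g2 g int_pow[OF True] G(3)[OF g] in auto)
      have "(\<integral>z. (if u z \<le> K then g z else 0)\<^sup>2 \<partial>P) \<le> (\<integral>z. (g z)\<^sup>2 \<partial>P)"
        by (rule integral_mono'[OF gi]) auto
      then show "(\<integral>z. (if u z \<le> K then g z else 0)\<^sup>2 \<partial>P) \<le> \<tau> * v\<^sup>2" using v(2)[OF g True] by linarith
    qed (use u(6) v(1) in auto)
    have gauss: "sqrt (\<tau> * v\<^sup>2 * (L / real n)) \<le> \<tau> * \<Lambda> * (v * T powr (- (1 / 2)))"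
    proof -
      have "\<tau> * v\<^sup>2 * (L / real n) \<le> \<tau> * v\<^sup>2 * (\<Lambda> / T)" using L u(6) by (intro mult_left_mono) auto
      then have "sqrt (\<tau> * v\<^sup>2 * (L / real n)) \<le> sqrt (\<tau> * v\<^sup>2 * (\<Lambda> / T))" by (rule real_sqrt_le_mono)
      also have "\<dots> = sqrt (\<tau> * \<Lambda>) * (v / sqrt T)"
        using v(1) by (simp add: real_sqrt_mult real_sqrt_divide)
      also have "v / sqrt T = v * T powr (- (1 / 2))"
        using L by (simp add: powr_minus_divide powr_half_sqrt)
      also have "sqrt (\<tau> * \<Lambda>) * (v * T powr (- (1 / 2))) \<le> \<tau> * \<Lambda> * (v * T powr (- (1 / 2)))"
        using v(1) sq by (intro mult_right_mono) auto
      finally show ?thesis .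
    qed
    show ?thesis
    proof (rule mean_sup_dev_le_mono[OF base])
      have "0 \<le> \<tau> * \<Lambda> * (v * T powr (- (1 / 2)))" "0 \<le> \<tau> * \<Lambda> * (r * T powr - q)" using u(6) L v(1) r(1) by auto
      then show "2 * sqrt (\<tau> * v\<^sup>2 * (L / real n)) + 2 * (r * K) * (L / real n) + 2 * (r * (K powr (1 - m) * \<tau>))
        \<le> 6 * \<tau> * \<Lambda> * (r * T powr (- (1 - 1 / m)) + v * T powr (- (1 / 2)))"
        using gauss rest unfolding q_def[symmetric] by (simp add: algebra_simps)
    qed
  next
    case False
    have base: "mean_sup_dev_le G (2 * sqrt (r\<^sup>2 * (K powr (2 - m) * \<tau>) * (L / real n)) + 2 * (r * K) * (L / real n) + 2 * (r * (K powr (1 - m) * \<tau>)))"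
    proof (rule A)
      fix g assume g: "g \<in> G"
      have le: "(if u z \<le> K then g z else 0)\<^sup>2 \<le> r\<^sup>2 * (K powr (2 - m) * u z powr m)" if z: "z \<in> space P" for z
      proof (cases "u z \<le> K")
        case True
        have "(u z)\<^sup>2 = u z powr (2 - m) * u z powr m"
          using u(2)[OF z] by (cases "u z = 0") (auto simp flip: powr_add)
        also have "\<dots> \<le> K powr (2 - m) * u z powr m"
          using True u(2)[OF z] False by (intro mult_right_mono powr_mono2) auto
        finally have "r\<^sup>2 * (u z)\<^sup>2 \<le> r\<^sup>2 * (K powr (2 - m) * u z powr m)" by (intro mult_left_mono) auto
        then show ?thesis using True g2[OF g z] by simp
      qed simp
      have "(\<integral>z. (if u z \<le> K then g z else 0)\<^sup>2 \<partial>P) \<le> (\<integral>z. r\<^sup>2 * (K powr (2 - m) * u z powr m) \<partial>P)"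
        by (rule integral_mono') (use u le in auto)
      also have "\<dots> = r\<^sup>2 * (K powr (2 - m) * (\<integral>z. u z powr m \<partial>P))" by simp
      also have "\<dots> \<le> r\<^sup>2 * (K powr (2 - m) * \<tau>)" using u(4) by (intro mult_left_mono) auto
      finally show "(\<integral>z. (if u z \<le> K then g z else 0)\<^sup>2 \<partial>P) \<le> r\<^sup>2 * (K powr (2 - m) * \<tau>)" .
    qed (use u(6) r(1) K in auto)
    have gauss: "sqrt (r\<^sup>2 * (K powr (2 - m) * \<tau>) * (L / real n)) \<le> \<tau> * \<Lambda> * (r * T powr - q)"
    proof -
      have "r\<^sup>2 * (K powr (2 - m) * \<tau>) * (L / real n) \<le> r\<^sup>2 * (K powr (2 - m) * \<tau>) * (\<Lambda> / T)"
        using L u(6) by (intro mult_left_mono) auto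
      also have "\<dots> = (\<tau> * \<Lambda>) * (r\<^sup>2 * (K powr (2 - m) / T))" by simp
      finally have "sqrt (r\<^sup>2 * (K powr (2 - m) * \<tau>) * (L / real n)) \<le> sqrt ((\<tau> * \<Lambda>) * (r\<^sup>2 * (K powr (2 - m) / T)))"
        by (rule real_sqrt_le_mono)
      also have "\<dots> = sqrt (\<tau> * \<Lambda>) * (r * T powr - q)"
        using r(1) K_T(3) by (simp only: real_sqrt_mult) simp
      also have "\<dots> \<le> \<tau> * \<Lambda> * (r * T powr - q)"
        using r(1) sq by (intro mult_right_mono) auto
      finally show ?thesis .
    qed
    show ?thesis
    proof (rule mean_sup_dev_le_mono[OF base])
      have "0 \<le> \<tau> * \<Lambda> * (v * T powr (- (1 / 2)))" using u(6) L v(1) by auto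
      then show "2 * sqrt (r\<^sup>2 * (K powr (2 - m) * \<tau>) * (L / real n)) + 2 * (r * K) * (L / real n) + 2 * (r * (K powr (1 - m) * \<tau>))
        \<le> 6 * \<tau> * \<Lambda> * (r * T powr (- (1 - 1 / m)) + v * T powr (- (1 / 2)))"
        using gauss rest unfolding q_def[symmetric] by (simp add: algebra_simps)
    qed
  qed
qed

end

section \<open>Conditional second moments\<close>

lemma fst_measurable_pair:
  assumes "sets P = sets (MX \<Otimes>\<^sub>M MY)"
  shows "fst \<in> measurable P MX"
  using measurable_cong_sets[OF assms refl] by auto

lemma subalgebra_vimage_fst:
  assumes "sets P = sets (MX \<Otimes>\<^sub>M MY)"
  shows "subalgebra P (vimage_algebra (space P) fst MX)"
  unfolding subalgebra_def using fst_measurable_pair[OF assms]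
  by (auto simp: sets_vimage_algebra2 measurable_def intro: measurable_sets)

text \<open>Since \<open>d\<close> depends on the first component only, it can be pulled out of the conditional expectation of
  \<open>u\<^sup>2\<close> given that component. This trades the heavy-tailed factor for a constant and leaves the
  \<open>L\<^sup>2\<close> norm of \<open>d\<close>, instead of its uniform norm.\<close>
lemma integral_square_le_conditional_moment:
  fixes d :: "'x \<Rightarrow> real" and u :: "'x \<times> 'y \<Rightarrow> real"
  assumes "prob_space P" and sets_P: "sets P = sets (MX \<Otimes>\<^sub>M MY)"
    and u: "u \<in> borel_measurable P" "integrable P (\<lambda>z. (u z)\<^sup>2)"
    and ce: "AE z in P. \<bar>real_cond_exp P (vimage_algebra (space P) fst MX) (\<lambda>z. (u z)\<^sup>2) z\<bar> \<le> \<tau>"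
    and d: "d \<in> borel_measurable MX" "\<And>x. x \<in> space MX \<Longrightarrow> \<bar>d x\<bar> \<le> b"
  shows "(\<integral>z. (u z * d (fst z))\<^sup>2 \<partial>P) \<le> \<tau> * (\<integral>z. (d (fst z))\<^sup>2 \<partial>P)"
proof -
  interpret prob_space P by fact
  define F where "F = vimage_algebra (space P) fst MX"
  have sp: "space P = space MX \<times> space MY" using sets_eq_imp_space_eq[OF sets_P] by (simp add: space_pair_measure)
  have "subalgebra P F" unfolding F_def by (rule subalgebra_vimage_fst[OF sets_P])
  then interpret finite_measure_subalgebra P F by unfold_locales
  have dF: "(\<lambda>z. (d (fst z))\<^sup>2) \<in> borel_measurable F"
  proof -
    have "fst \<in> measurable F MX" unfolding F_def by (rule measurable_vimage_algebra1) (auto simp: sp)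
    then show ?thesis using d(1) by measurable
  qed
  then have dP: "(\<lambda>z. (d (fst z))\<^sup>2) \<in> borel_measurable P"
    using subalg by (rule measurable_from_subalg[rotated])
  have d2: "(d (fst z))\<^sup>2 \<le> b\<^sup>2" if "z \<in> space P" for z
    using power_mono[OF d(2), of "fst z" 2] that by (auto simp: sp)
  have i1: "integrable P (\<lambda>z. (d (fst z))\<^sup>2 * (u z)\<^sup>2)"
  proof (rule Bochner_Integration.integrable_bound[where f = "\<lambda>z. b\<^sup>2 * (u z)\<^sup>2"])
    show "(\<lambda>z. (d (fst z))\<^sup>2 * (u z)\<^sup>2) \<in> borel_measurable P" using dP u(1) by measurable
  qed (use u(2) d2 in \<open>auto simp: abs_mult intro!: mult_right_mono\<close>)
  note ce_int = real_cond_exp_intg[OF i1 dF borel_measurable_power[OF u(1), of 2]]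
  have i2: "integrable P (\<lambda>z. (d (fst z))\<^sup>2)"
    by (rule integrable_const_bound[where B = "b\<^sup>2"]) (use d2 dP in auto)
  have "(\<integral>z. (u z * d (fst z))\<^sup>2 \<partial>P) = (\<integral>z. (d (fst z))\<^sup>2 * (u z)\<^sup>2 \<partial>P)"
    by (simp add: power_mult_distrib mult.commute)
  also have "\<dots> = (\<integral>z. (d (fst z))\<^sup>2 * real_cond_exp P F (\<lambda>z. (u z)\<^sup>2) z \<partial>P)"
    using ce_int(2) by simp
  also have "\<dots> \<le> (\<integral>z. (d (fst z))\<^sup>2 * \<tau> \<partial>P)"
  proof (rule integral_mono_AE[OF ce_int(1)])
    show "AE z in P. (d (fst z))\<^sup>2 * real_cond_exp P F (\<lambda>z. (u z)\<^sup>2) z \<le> (d (fst z))\<^sup>2 * \<tau>"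
      using ce unfolding F_def[symmetric] by eventually_elim (auto intro!: mult_left_mono)
  qed (use i2 in auto)
  also have "\<dots> = \<tau> * (\<integral>z. (d (fst z))\<^sup>2 \<partial>P)" by simp
  finally show ?thesis .
qed
lemma conditional_square_bounded:
  fixes v :: "'x \<times> 'y \<Rightarrow> real"
  assumes "prob_space P" and sets_P: "sets P = sets (MX \<Otimes>\<^sub>M MY)"
    and v: "v \<in> borel_measurable P" "\<And>z. z \<in> space P \<Longrightarrow> 0 \<le> v z"
    and fin: "esssup P (\<lambda>z. ereal \<bar>real_cond_exp P (vimage_algebra (space P) fst MX) (\<lambda>z. v z powr 2) z\<bar>) < \<infinity>"
  shows "\<exists>\<sigma>. AE z in P. \<bar>real_cond_exp P (vimage_algebra (space P) fst MX) (\<lambda>z. (v z)\<^sup>2) z\<bar> \<le> \<sigma>"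
proof -
  interpret prob_space P by fact
  define A where "A = vimage_algebra (space P) fst MX"
  have "subalgebra P A" unfolding A_def by (rule subalgebra_vimage_fst[OF sets_P])
  then interpret finite_measure_subalgebra P A by unfold_locales
  define g where "g z = ereal \<bar>real_cond_exp P A (\<lambda>z. v z powr 2) z\<bar>" for z
  have "AE z in P. g z \<le> esssup P g" by (rule esssup_AE)
  moreover obtain \<sigma> where "esssup P g \<le> ereal \<sigma>"
    using fin unfolding g_def[abs_def] A_def by (cases "esssup P g") (auto simp: g_def[abs_def] A_def)
  ultimately have "AE z in P. \<bar>real_cond_exp P A (\<lambda>z. v z powr 2) z\<bar> \<le> \<sigma>"
    by (auto simp: g_def elim!: eventually_mono) (metis ereal_less_eq(3) order_trans)
  moreover have "AE z in P. real_cond_exp P A (\<lambda>z. v z powr 2) z = real_cond_exp P A (\<lambda>z. (v z)\<^sup>2) z"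
    by (rule real_cond_exp_cong) (use v in auto)
  ultimately have "AE z in P. \<bar>real_cond_exp P A (\<lambda>z. (v z)\<^sup>2) z\<bar> \<le> \<sigma>" by eventually_elim simp
  then show ?thesis unfolding A_def by blast
qed

section \<open>Nets and projections\<close>

lemma log_covering_le_net:
  assumes "log_covering_le h K d b" "K \<noteq> {}"
  obtains C where "finite C" "C \<subseteq> K" "C \<noteq> {}" "\<And>p. p \<in> K \<Longrightarrow> \<exists>c\<in>C. d p c \<le> h" "ln (real (card C)) \<le> b"
proof -
  define A where "A = (\<lambda>C. enat (card C)) ` {C. finite C \<and> C \<subseteq> K \<and> (\<forall>p\<in>K. \<exists>c\<in>C. d p c \<le> h)}"
  obtain N where N: "Inf A = enat N" "ln (real N) \<le> b"
    using assms(1) unfolding log_covering_le_def covering_number_def A_def by auto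
  then have "A \<noteq> {}" by (auto simp: Inf_enat_def)
  then have "Inf A \<in> A" by (meson ex_in_conv wellorder_InfI)
  then obtain C where C: "finite C" "C \<subseteq> K" "\<And>p. p \<in> K \<Longrightarrow> \<exists>c\<in>C. d p c \<le> h" "card C = N"
    using N(1) unfolding A_def by auto
  moreover have "C \<noteq> {}" using C(3) assms(2) by blast
  ultimately show thesis using that N(2) by blast
qed

lemma unif_dist_pointwise:
  assumes "unif_dist S f g \<le> h" "x \<in> S"
    and "\<And>x. x \<in> S \<Longrightarrow> \<bar>f x\<bar> \<le> M" "\<And>x. x \<in> S \<Longrightarrow> \<bar>g x\<bar> \<le> M"
  shows "\<bar>f x - g x\<bar> \<le> h"
proof -
  have "bdd_above ((\<lambda>x. \<bar>f x - g x\<bar>) ` S)"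
    by (rule bdd_aboveI2[where M = "M + M"]) (use assms(3,4) in fastforce)
  then have "\<bar>f x - g x\<bar> \<le> (SUP x\<in>S. \<bar>f x - g x\<bar>)" by (rule cSUP_upper[OF assms(2)])
  then show ?thesis using assms(1) by (simp add: unif_dist_def unif_norm_def)
qed

text \<open>The centres of a net of \<open>F\<close> may lie outside \<open>B\<close>. Replacing each centre by a representative in \<open>B\<close> of
  the points assigned to it doubles the radius but does not increase the cardinality. Chains then stay
  inside a ball, so that every link inherits the \<open>L\<^sup>2\<close> radius of that ball.\<close>
lemma projection_within:
  fixes B F :: "('x \<Rightarrow> real) set"
  assumes "finite C" "\<And>f. f \<in> F \<Longrightarrow> \<exists>c\<in>C. \<forall>x\<in>S. \<bar>f x - c x\<bar> \<le> h / 2" "B \<subseteq> F"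
  shows "\<exists>\<pi>. \<pi> ` B \<subseteq> B \<and> finite (\<pi> ` B) \<and> card (\<pi> ` B) \<le> card C
    \<and> (\<forall>f\<in>B. \<forall>x\<in>S. \<bar>f x - \<pi> f x\<bar> \<le> h)"
proof -
  define c where "c f = (SOME c. c \<in> C \<and> (\<forall>x\<in>S. \<bar>f x - c x\<bar> \<le> h / 2))" for f
  have c: "c f \<in> C" "\<And>x. x \<in> S \<Longrightarrow> \<bar>f x - c f x\<bar> \<le> h / 2" if "f \<in> F" for f
    using someI_ex[of "\<lambda>c. c \<in> C \<and> (\<forall>x\<in>S. \<bar>f x - c x\<bar> \<le> h / 2)"] assms(2)[OF that]
    unfolding c_def by blast+
  define rep where "rep k = (SOME g. g \<in> B \<and> c g = k)" for k
  have rep: "rep (c f) \<in> B" "c (rep (c f)) = c f" if "f \<in> B" for f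
    using someI[of "\<lambda>g. g \<in> B \<and> c g = c f" f] that unfolding rep_def by auto
  have cB: "c ` B \<subseteq> C" using c assms(3) by auto
  have im: "(\<lambda>f. rep (c f)) ` B = rep ` (c ` B)" by auto
  have fin: "finite (c ` B)" using cB assms(1) finite_subset by blast
  have "card ((\<lambda>f. rep (c f)) ` B) \<le> card C"
    unfolding im using card_image_le[OF fin, of rep] card_mono[OF assms(1) cB] by linarith
  moreover have "\<bar>f x - rep (c f) x\<bar> \<le> h" if "f \<in> B" "x \<in> S" for f x
  proof -
    have "f \<in> F" "rep (c f) \<in> F" using rep[OF that(1)] that assms(3) by auto
    then have "\<bar>f x - c f x\<bar> \<le> h / 2" "\<bar>rep (c f) x - c f x\<bar> \<le> h / 2"
      using c(2)[of f x] c(2)[of "rep (c f)" x] rep(2)[OF that(1)] that(2) by auto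
    then show ?thesis by linarith
  qed
  ultimately show ?thesis using rep im fin by (intro exI[of _ "\<lambda>f. rep (c f)"]) auto
qed

section \<open>Rates\<close>

lemma rpow_le_powr:
  assumes "0 \<le> x" "x \<le> \<delta>" "0 < \<delta>" "0 \<le> s"
  shows "rpow x s \<le> \<delta> powr s"
  using assms by (auto simp: rpow_def intro: powr_mono2)

lemma log_plus_ge_1: "1 \<le> log_plus x"
  by (simp add: log_plus_def)

lemma log_plus_mult_le:
  assumes "1 \<le> A" "1 \<le> x"
  shows "log_plus (A * x) \<le> (1 + ln A) * log_plus x"
proof -
  have "ln (A * x) \<le> ln A * log_plus x + 1 * log_plus x"
    using assms mult_left_mono[OF log_plus_ge_1[of x], of "ln A"]
    by (simp add: ln_mult) (simp add: log_plus_def)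
  moreover have "1 * 1 \<le> (1 + ln A) * log_plus x"
    using assms log_plus_ge_1[of x] by (intro mult_mono) auto
  ultimately show ?thesis by (simp add: log_plus_def distrib_right)
qed

text \<open>Since \<open>h \<ge> 1 / n\<close>, the logarithm in the entropy bound is of order \<open>log n\<close>; since \<open>h \<le> H\<close> and
  \<open>D \<ge> 1\<close>, the additive constant is absorbed into \<open>D * h powr (- \<gamma>)\<close>. The factor \<open>2\<close> in front of the
  entropy is there because a link consists of two net points.\<close>
lemma entropy_at_half_scale_le:
  fixes n :: nat
  assumes h: "1 / real n \<le> h" "h \<le> H" "1 \<le> H" and n: "1 \<le> n" and D: "1 \<le> D"
    and c: "0 \<le> \<gamma>" "0 < C0" "1 \<le> U0" "0 \<le> a0"
  shows "1 + ln 2 + 2 * (C0 * D * (h / 2) powr (- \<gamma>) * log_plus (U0 / (h / 2)) powr a0)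
    \<le> (2 * H powr \<gamma> + 2 * (C0 * 2 powr \<gamma> * (1 + ln (2 * U0)) powr a0)) * log_plus (real n) powr a0
        * (D * h powr (- \<gamma>))"
proof -
  let ?l = "log_plus (real n) powr a0"
  have h0: "0 < h" using h n by (simp add: field_simps) (smt (verit) mult_nonneg_nonpos2 of_nat_0_le_iff zero_less_mult_iff)
  have l1: "1 \<le> ?l" using log_plus_ge_1 c by (simp add: ge_one_powr_ge_zero)
  have Dh: "1 \<le> H powr \<gamma> * (D * h powr (- \<gamma>))"
  proof -
    have "1 = H powr \<gamma> * (1 * H powr (- \<gamma>))" using h by (simp flip: powr_add)
    also have "\<dots> \<le> H powr \<gamma> * (D * h powr (- \<gamma>))"
      using D h h0 c by (intro mult_left_mono mult_mono powr_mono2') auto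
    finally show ?thesis .
  qed
  have "1 + ln 2 \<le> (2::real)" using ln_2_less_1 by simp
  also have "\<dots> \<le> 2 * (H powr \<gamma> * (D * h powr (- \<gamma>)) * ?l)"
    using mult_mono[OF Dh l1] Dh by simp
  finally have 1: "1 + ln 2 \<le> 2 * H powr \<gamma> * ?l * (D * h powr (- \<gamma>))" by (simp add: mult_ac)
  have "log_plus (U0 / (h / 2)) \<le> log_plus (2 * U0 * real n)"
  proof -
    have "1 / h \<le> real n" using h h0 n by (simp add: field_simps)
    then have "2 * U0 * (1 / h) \<le> 2 * U0 * real n" using c by (intro mult_left_mono) auto
    then show ?thesis using h0 c n unfolding log_plus_def by (intro max.mono) (auto simp: field_simps)
  qed
  also have "\<dots> \<le> (1 + ln (2 * U0)) * log_plus (real n)"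
    using c n by (intro log_plus_mult_le) auto
  finally have "log_plus (U0 / (h / 2)) powr a0 \<le> ((1 + ln (2 * U0)) * log_plus (real n)) powr a0"
    using c log_plus_ge_1[of "U0 / (h/2)"] by (intro powr_mono2) auto
  also have "\<dots> = (1 + ln (2 * U0)) powr a0 * ?l"
    by (rule powr_mult)
  finally have 2: "log_plus (U0 / (h / 2)) powr a0 \<le> (1 + ln (2 * U0)) powr a0 * ?l" .
  have 3: "(h / 2) powr (- \<gamma>) = 2 powr \<gamma> * h powr (- \<gamma>)"
    using h0 by (simp add: powr_divide powr_minus_divide)
  have "C0 * D * (h / 2) powr (- \<gamma>) * log_plus (U0 / (h / 2)) powr a0
     \<le> C0 * D * (h / 2) powr (- \<gamma>) * ((1 + ln (2 * U0)) powr a0 * ?l)"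
    using 2 c D by (intro mult_left_mono) auto
  also have "\<dots> = C0 * 2 powr \<gamma> * (1 + ln (2 * U0)) powr a0 * ?l * (D * h powr (- \<gamma>))"
    unfolding 3 by (simp add: mult_ac)
  finally show ?thesis using 1 by (simp add: distrib_right)
qed

text \<open>One depth of order \<open>log n\<close> serves both the chain, whose ratio of scales is polynomial in \<open>n\<close>, and the
  dyadic shells in the peeling argument.\<close>
lemma dyadic_depth:
  fixes n :: nat
  assumes "0 < A" "1 \<le> n"
  obtains J :: nat where "A * real n \<le> 2 ^ J" "real J + 1 \<le> (2 * ln (A + 1) + 4) * log_plus (real n)"
proof -
  define x where "x = (A + 1) * real n"
  have x: "1 \<le> x" "A * real n \<le> x" using assms mult_mono[of 1 "A + 1" 1 "real n"] by (auto simp: x_def distrib_right)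
  define J where "J = nat \<lceil>log 2 x\<rceil>"
  have "x = 2 powr log 2 x" using x by simp
  also have "\<dots> \<le> 2 powr real J" unfolding J_def by (intro powr_mono) (auto simp: real_nat_ceiling_ge)
  also have "\<dots> = 2 ^ J" by (simp add: powr_realpow)
  finally have 1: "A * real n \<le> 2 ^ J" using x by linarith
  have "real J \<le> log 2 x + 1" using x unfolding J_def by (simp add: of_nat_ceiling)
  moreover have "log 2 x \<le> 2 * ln x"
  proof -
    have "1 / 2 \<le> ln (2::real)" using ln2_ge_two_thirds by linarith
    then have "ln x / ln 2 \<le> ln x / (1 / 2)" using x by (intro divide_left_mono) auto
    then show ?thesis by (simp add: log_def)
  qed
  moreover have "ln x = ln (A + 1) + ln (real n)" using assms by (simp add: x_def ln_mult)
  moreover have "ln (real n) \<le> log_plus (real n)" by (simp add: log_plus_def)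
  moreover have "ln (A + 1) \<le> ln (A + 1) * log_plus (real n)"
    using mult_left_mono[OF log_plus_ge_1, of "ln (A + 1)" "real n"] assms by simp
  ultimately have "real J + 1 \<le> (2 * ln (A + 1) + 4) * log_plus (real n)"
    using log_plus_ge_1[of "real n"] by (simp add: distrib_right)
  with 1 show thesis by (rule that)
qed

text \<open>For \<open>\<gamma> \<ge> 1\<close> this is the scale \<open>h\<close> with \<open>t * h\<^sup>\<gamma> = 1\<close>, at which the entropy reaches the sample
  size and refining the net no longer pays. For \<open>\<gamma> < 1\<close> that scale would be needlessly small, and
  \<open>1 / t\<close>, which is at most the square of the rate to be proved, replaces it.\<close>
definition finest_scale :: "real \<Rightarrow> real \<Rightarrow> real"
  where "finest_scale \<gamma> t = t powr (- (1 / max \<gamma> 1))"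

lemma finest_scale:
  assumes "1 \<le> t" "0 \<le> \<gamma>"
  shows "0 < finest_scale \<gamma> t" "finest_scale \<gamma> t \<le> 1" "1 / t \<le> finest_scale \<gamma> t"
    "1 \<le> t * finest_scale \<gamma> t powr \<gamma>"
    "finest_scale \<gamma> t \<le> (t powr (- entropy_exponent \<gamma>))\<^sup>2"
proof -
  show "0 < finest_scale \<gamma> t" using assms by (simp add: finest_scale_def)
  show "finest_scale \<gamma> t \<le> 1"
    using assms powr_mono[of "- (1 / max \<gamma> 1)" 0 t] by (simp add: finest_scale_def)
  have "t powr (- 1) \<le> finest_scale \<gamma> t"
    unfolding finest_scale_def using assms by (intro powr_mono) (auto simp: field_simps)
  then show "1 / t \<le> finest_scale \<gamma> t" using assms by (simp add: powr_minus_divide)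
  have "t * finest_scale \<gamma> t powr \<gamma> = t powr 1 * t powr (- (1 / max \<gamma> 1) * \<gamma>)"
    using assms unfolding finest_scale_def powr_powr by simp
  also have "\<dots> = t powr (1 - \<gamma> / max \<gamma> 1)" by (simp only: powr_add[symmetric]) simp
  also have "\<dots> \<ge> 1" using assms by (intro ge_one_powr_ge_zero) auto
  finally show "1 \<le> t * finest_scale \<gamma> t powr \<gamma>" .
  have "2 * entropy_exponent \<gamma> \<le> 1 / max \<gamma> 1"
    using assms by (auto simp: entropy_exponent_def max_def min_def field_simps)
  then have "finest_scale \<gamma> t \<le> t powr (- (2 * entropy_exponent \<gamma>))"
    unfolding finest_scale_def using assms by (intro powr_mono) auto
  also have "\<dots> = (t powr (- entropy_exponent \<gamma>))\<^sup>2"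
    using powr_add[of t "- entropy_exponent \<gamma>" "- entropy_exponent \<gamma>"] by (simp add: power2_eq_square)
  finally show "finest_scale \<gamma> t \<le> (t powr (- entropy_exponent \<gamma>))\<^sup>2" .
qed

lemma scale_times_power:
  fixes t h p \<gamma> :: real
  assumes "0 < t" "0 < h"
  shows "h * (t * h powr \<gamma>) powr (- p) = t powr (- p) * h powr (1 - \<gamma> * p)"
proof -
  have "h * (t * h powr \<gamma>) powr (- p) = t powr (- p) * (h powr 1 * h powr (\<gamma> * (- p)))"
    using assms by (simp add: powr_mult powr_powr)
  also have "h powr 1 * h powr (\<gamma> * (- p)) = h powr (1 - \<gamma> * p)"
    by (simp only: powr_add[symmetric]) simp
  finally show ?thesis .
qed

text \<open>The quantity is a power of \<open>h\<close> with exponent \<open>1 - \<gamma> * p \<le> 0\<close>, hence largest at the finest scale,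
  where \<open>t * h\<^sup>\<gamma> \<ge> 1\<close>.\<close>
lemma scale_times_power_le_finest:
  assumes "1 \<le> t" "0 \<le> \<gamma>" "0 \<le> p" "1 \<le> \<gamma> * p" "finest_scale \<gamma> t \<le> h"
  shows "h * (t * h powr \<gamma>) powr (- p) \<le> finest_scale \<gamma> t"
proof -
  let ?f = "finest_scale \<gamma> t"
  note f = finest_scale[OF assms(1,2)]
  have "h * (t * h powr \<gamma>) powr (- p) \<le> ?f * (t * ?f powr \<gamma>) powr (- p)"
    using assms f by (subst (1 2) scale_times_power) (auto intro!: mult_left_mono powr_mono2')
  also have "(t * ?f powr \<gamma>) powr (- p) \<le> 1 powr (- p)"
    using assms f by (intro powr_mono2') auto
  finally show ?thesis using f(1) by (simp add: mult_left_le)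
qed

text \<open>If \<open>\<gamma> * q < 1\<close>, the left side increases with \<open>h\<close> and it remains to compare its value at
  \<open>h = A * \<delta>\<^sup>s\<close> with \<open>\<delta> * e\<close>. Putting \<open>b\<close> for the second rate, \<open>t powr (- q)\<close> is
  \<open>b powr (2 - s + s * \<gamma> * q)\<close>, and \<open>\<delta> powr (s * (1 - \<gamma> * q) - 1)\<close> has a nonpositive exponent, so
  \<open>\<delta>\<close> may be replaced there by the smaller \<open>b\<close>; the exponents then add up to \<open>1\<close>.\<close>
lemma heavy_tail_scale_le:
  assumes t: "1 \<le> t" and \<gamma>: "0 \<le> \<gamma>" and q: "0 < q" "q < 1" and s: "0 \<le> s" "s \<le> 1"
    and A: "1 \<le> A" and e: "t powr (- entropy_exponent \<gamma>) \<le> e"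
    "t powr (- inverse ((2 - s) / q + s * \<gamma>)) \<le> e" and \<delta>: "e \<le> \<delta>"
    and h: "finest_scale \<gamma> t \<le> h" "h \<le> max (A * \<delta> powr s) (finest_scale \<gamma> t)"
  shows "h * (t * h powr \<gamma>) powr (- q) \<le> A * (\<delta> * e)"
proof -
  let ?f = "finest_scale \<gamma> t"
  note f = finest_scale[OF t \<gamma>]
  have e0: "0 < e" using e t by (smt (verit) powr_gt_zero)
  then have \<delta>0: "0 < \<delta>" using \<delta> by simp
  have "?f \<le> e\<^sup>2" using f(5) power_mono[OF e(1), of 2] by simp
  also have "\<dots> \<le> 1 * (\<delta> * e)" using \<delta> e0 by (simp add: power2_eq_square)
  also have "\<dots> \<le> A * (\<delta> * e)" using A \<delta>0 e0 by (intro mult_right_mono) auto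
  finally have f_le: "?f \<le> A * (\<delta> * e)" .
  show ?thesis
  proof (cases "1 \<le> \<gamma> * q")
    case True
    then show ?thesis using scale_times_power_le_finest[OF t \<gamma> _ True h(1)] q f_le by linarith
  next
    case False
    show ?thesis
    proof (cases "h \<le> A * \<delta> powr s")
      case True
      define w where "w = (2 - s) / q + s * \<gamma>"
      define b where "b = t powr (- inverse w)"
      have w0: "0 < w" unfolding w_def using q s \<gamma> by (intro add_pos_nonneg) auto
      have b: "0 < b" "b \<le> e" using e t by (auto simp: b_def w_def)
      have "w * q = 2 - s + s * \<gamma> * q" using q by (simp add: w_def field_simps)
      moreover have "t powr (- q) = b powr (w * q)"
        using w0 by (simp add: b_def powr_powr mult.assoc[symmetric])
      ultimately have tq: "t powr (- q) = b powr (2 - s + s * \<gamma> * q)" by simp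
      have "h * (t * h powr \<gamma>) powr (- q) = t powr (- q) * h powr (1 - \<gamma> * q)"
        using t f(1) h(1) by (intro scale_times_power) auto
      also have "\<dots> \<le> t powr (- q) * (A * \<delta> powr s) powr (1 - \<gamma> * q)"
        using False True f(1) h(1) by (intro mult_left_mono powr_mono2) auto
      also have "(A * \<delta> powr s) powr (1 - \<gamma> * q) = A powr (1 - \<gamma> * q) * \<delta> powr (s * (1 - \<gamma> * q))"
        by (simp add: powr_mult powr_powr)
      also have "\<dots> \<le> A powr 1 * \<delta> powr (s * (1 - \<gamma> * q))"
        using A \<gamma> q by (intro mult_right_mono powr_mono) auto
      also have "\<delta> powr (s * (1 - \<gamma> * q)) = \<delta> * \<delta> powr (s * (1 - \<gamma> * q) - 1)"
        using \<delta>0 by (simp add: powr_diff)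
      also have "\<delta> powr (s * (1 - \<gamma> * q) - 1) \<le> b powr (s * (1 - \<gamma> * q) - 1)"
      proof (rule powr_mono2')
        have "s * (1 - \<gamma> * q) \<le> 1 * 1" using s \<gamma> q False by (intro mult_mono) auto
        then show "s * (1 - \<gamma> * q) - 1 \<le> 0" by simp
      qed (use b \<delta> in auto)
      finally have "h * (t * h powr \<gamma>) powr (- q)
          \<le> t powr (- q) * (A powr 1 * (\<delta> * b powr (s * (1 - \<gamma> * q) - 1)))"
        using A \<delta>0 by (simp add: mult_left_mono)
      also have "\<dots> = A * (\<delta> * (b powr (2 - s + s * \<gamma> * q) * b powr (s * (1 - \<gamma> * q) - 1)))"
        using A unfolding tq by simp
      also have "b powr (2 - s + s * \<gamma> * q) * b powr (s * (1 - \<gamma> * q) - 1) = b"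
        using b by (simp flip: powr_add) (simp add: algebra_simps)
      also have "A * (\<delta> * b) \<le> A * (\<delta> * e)" using A \<delta>0 b by simp
      finally show ?thesis .
    next
      case 2: False
      then have [simp]: "h = ?f" using h by auto
      have "(t * h powr \<gamma>) powr (- q) \<le> 1 powr (- q)" using f q by (intro powr_mono2') auto
      then have "h * (t * h powr \<gamma>) powr (- q) \<le> ?f" using f(1) by (simp add: mult_left_le)
      then show ?thesis using f_le by linarith
    qed
  qed
qed

text \<open>If \<open>\<gamma> < 2\<close>, the left side is largest at \<open>h = \<delta>\<close>, where it is \<open>\<delta>\<close> times \<open>(t * \<delta>\<^sup>\<gamma>) powr (- 1/2)\<close>;
  that factor decreases in \<open>\<delta>\<close> and has the fixed point \<open>b = t powr (- 1 / (2 + \<gamma>))\<close>.\<close>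
lemma gaussian_scale_le:
  assumes t: "1 \<le> t" and \<gamma>: "0 \<le> \<gamma>" and e: "t powr (- entropy_exponent \<gamma>) \<le> e" and \<delta>: "e \<le> \<delta>"
    and h: "finest_scale \<gamma> t \<le> h"
  shows "min h \<delta> * (t * h powr \<gamma>) powr (- (1 / 2)) \<le> \<delta> * e"
proof -
  let ?f = "finest_scale \<gamma> t"
  note f = finest_scale[OF t \<gamma>]
  have e0: "0 < e" using e t by (smt (verit) powr_gt_zero)
  then have \<delta>0: "0 < \<delta>" using \<delta> by simp
  have h0: "0 < h" using f h by linarith
  have "?f \<le> e\<^sup>2" using f(5) power_mono[OF e(1), of 2] by simp
  also have "\<dots> \<le> \<delta> * e" using \<delta> e0 by (simp add: power2_eq_square)
  finally have f_le: "?f \<le> \<delta> * e" .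
  show ?thesis
  proof (cases "2 \<le> \<gamma>")
    case True
    have "min h \<delta> * (t * h powr \<gamma>) powr (- (1 / 2)) \<le> h * (t * h powr \<gamma>) powr (- (1 / 2))"
      by (intro mult_right_mono) auto
    also have "\<dots> \<le> ?f" using scale_times_power_le_finest[OF t \<gamma> _ _ h, of "1/2"] True by simp
    finally show ?thesis using f_le by linarith
  next
    case False
    define b where "b = t powr (- (1 / (2 + \<gamma>)))"
    have ee: "entropy_exponent \<gamma> = 1 / (2 + \<gamma>)"
    proof (cases "\<gamma> = 0")
      case 2: False
      then have "1 / (2 + \<gamma>) \<le> 1 / (2 * \<gamma>)" using False \<gamma> by (intro divide_left_mono) auto
      then show ?thesis using 2 by (simp add: entropy_exponent_def)
    qed (simp add: entropy_exponent_def)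
    have b: "0 < b" "b \<le> e" using e t unfolding ee by (auto simp: b_def)
    have tb: "t powr (- (1 / 2)) = b powr ((2 + \<gamma>) / 2)"
    proof -
      have "2 + \<gamma> \<noteq> 0" using \<gamma> by linarith
      then have "- (1 / (2 + \<gamma>)) * ((2 + \<gamma>) / 2) = - (1 / 2)" by simp
      then show ?thesis unfolding b_def powr_powr by presburger
    qed
    have "min h \<delta> * (t * h powr \<gamma>) powr (- (1 / 2)) \<le> \<delta> * (t * \<delta> powr \<gamma>) powr (- (1 / 2))"
    proof (cases "\<delta> \<le> h")
      case True
      have "(t * h powr \<gamma>) powr (- (1 / 2)) \<le> (t * \<delta> powr \<gamma>) powr (- (1 / 2))"
        using True t \<delta>0 \<gamma> by (intro powr_mono2' mult_left_mono powr_mono2) auto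
      then show ?thesis using True \<delta>0 by (simp add: min_absorb2 mult_left_mono)
    next
      case 2: False
      then have "min h \<delta> * (t * h powr \<gamma>) powr (- (1 / 2)) = t powr (- (1 / 2)) * h powr (1 - \<gamma> * (1 / 2))"
        using scale_times_power[of t h \<gamma> "1/2"] t h0 by (simp add: min_def)
      also have "\<dots> \<le> t powr (- (1 / 2)) * \<delta> powr (1 - \<gamma> * (1 / 2))"
        using False 2 h0 by (intro mult_left_mono powr_mono2) auto
      also have "\<dots> = \<delta> * (t * \<delta> powr \<gamma>) powr (- (1 / 2))"
        using scale_times_power[of t \<delta> \<gamma> "1/2"] t \<delta>0 by simp
      finally show ?thesis .
    qed
    also have "(t * \<delta> powr \<gamma>) powr (- (1 / 2)) \<le> (t * b powr \<gamma>) powr (- (1 / 2))"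
      using b \<delta> \<gamma> t by (intro powr_mono2' mult_left_mono powr_mono2) auto
    also have "(t * b powr \<gamma>) powr (- (1 / 2)) = b powr ((2 + \<gamma>) / 2) * b powr (\<gamma> * (- (1 / 2)))"
      using t by (simp only: powr_mult powr_powr tb)
    also have "\<dots> = b" using b by (simp only: powr_add[symmetric]) (simp add: field_simps)
    finally have "min h \<delta> * (t * h powr \<gamma>) powr (- (1 / 2)) \<le> \<delta> * b" using \<delta>0 by (simp add: mult_left_mono)
    also have "\<dots> \<le> \<delta> * e" using b \<delta>0 by simp
    finally show ?thesis .
  qed
qed

text \<open>In the shell \<open>2 ^ (j - 1) * e < r \<le> 2 ^ j * e\<close> one factor \<open>r\<close> of \<open>r\<^sup>2\<close> can be divided out at the cost of
  \<open>2 ^ j * e / 2\<close>. Adding the bounds of all shells removes the dependence on the shell, so that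
  expectations can be taken when \<open>r\<close> is random.\<close>
lemma peeling:
  fixes r e \<alpha> \<beta> :: real and W :: "nat \<Rightarrow> real"
  assumes "0 < e" "0 \<le> \<alpha>" "0 \<le> \<beta>" "r \<le> 2 ^ J * e" "\<And>j. j \<le> J \<Longrightarrow> 0 \<le> W j"
    and basic: "\<And>j. j \<le> J \<Longrightarrow> r \<le> 2 ^ j * e \<Longrightarrow> r\<^sup>2 \<le> \<alpha> * W j + \<beta> * e\<^sup>2"
  shows "r \<le> (1 + 2 * \<beta>) * e + (\<Sum>j\<le>J. 2 * \<alpha> * (W j / (2 ^ j * e)))"
proof -
  define j where "j = (LEAST j. r \<le> 2 ^ j * e)"
  have j: "r \<le> 2 ^ j * e" "j \<le> J" unfolding j_def using assms(4) by (auto intro: LeastI Least_le)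
  have S0: "0 \<le> (\<Sum>j\<le>J. 2 * \<alpha> * (W j / (2 ^ j * e)))"
    using assms by (intro sum_nonneg mult_nonneg_nonneg divide_nonneg_nonneg) auto
  show ?thesis
  proof (cases j)
    case 0
    then have "r \<le> 1 * e" using j by simp
    also have "\<dots> \<le> (1 + 2 * \<beta>) * e" using assms by (intro mult_right_mono) auto
    finally show ?thesis using S0 by linarith
  next
    case (Suc i)
    have "\<not> r \<le> 2 ^ i * e" using Suc not_less_Least[of i "\<lambda>j. r \<le> 2 ^ j * e"] by (simp add: j_def)
    then have ri: "2 ^ j * e < 2 * r" using Suc by simp
    have je: "0 < 2 ^ j * e" using assms by simp
    have r0: "0 < r" using ri je by linarith
    have "2 ^ j * e * r \<le> 2 * r * r" using ri r0 by (intro mult_right_mono) auto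
    also have "\<dots> \<le> 2 * (\<alpha> * W j + \<beta> * e\<^sup>2)" using basic[OF j(2,1)] by (simp add: power2_eq_square)
    finally have "r \<le> 2 * (\<alpha> * W j + \<beta> * e\<^sup>2) / (2 ^ j * e)" using je by (simp add: field_simps)
    also have "\<dots> = 2 * \<alpha> * (W j / (2 ^ j * e)) + 2 * \<beta> * (e / 2 ^ j)"
      using assms(1) by (simp add: field_simps power2_eq_square)
    also have "2 * \<alpha> * (W j / (2 ^ j * e)) \<le> (\<Sum>j\<le>J. 2 * \<alpha> * (W j / (2 ^ j * e)))"
      by (rule member_le_sum[of j "{..J}" "\<lambda>j. 2 * \<alpha> * (W j / (2 ^ j * e))"]) (use j assms in auto)
    also have "2 * \<beta> * (e / 2 ^ j) \<le> (1 + 2 * \<beta>) * e"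
    proof -
      have "e / 2 ^ j \<le> e" using assms(1) by (simp add: field_simps)
      then have "2 * \<beta> * (e / 2 ^ j) \<le> 2 * \<beta> * e" using assms by (intro mult_left_mono) auto
      then show ?thesis using assms(1) by (simp add: distrib_right)
    qed
    finally show ?thesis by simp
  qed
qed

text \<open>The exponent \<open>entropy_exponent \<gamma>\<close> is chosen such that the finest scale, which is also the size of the
  discretization error of the chain, is at most the square of \<open>e\<close>.\<close>
lemma finest_scale_le_product:
  assumes "1 \<le> t" "0 \<le> \<gamma>" "t powr (- entropy_exponent \<gamma>) \<le> e" "e \<le> \<delta>"
  shows "finest_scale \<gamma> t \<le> \<delta> * e" "1 / t \<le> e" "0 < e"
proof -
  let ?p = "t powr (- entropy_exponent \<gamma>)"
  have p0: "0 < ?p" using assms by simp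
  then show e0: "0 < e" using assms by linarith
  have "finest_scale \<gamma> t \<le> ?p * ?p" using finest_scale(5)[OF assms(1,2)] by (simp add: power2_eq_square)
  also have "\<dots> \<le> \<delta> * e" using assms p0 e0 by (intro mult_mono) auto
  finally show "finest_scale \<gamma> t \<le> \<delta> * e" .
  have "0 \<le> entropy_exponent \<gamma>" using assms(2) by (auto simp: entropy_exponent_def)
  then have "?p \<le> t powr 0" using assms(1) by (intro powr_mono) auto
  then have "?p * ?p \<le> ?p * 1" using p0 assms(1) by (intro mult_left_mono) auto
  then show "1 / t \<le> e"
    using finest_scale(3,5)[OF assms(1,2)] assms(3) by (simp add: power2_eq_square)
qed

section \<open>Chaining for Lipschitz losses\<close>

text \<open>One constant \<open>\<tau>\<close> bounds all moments of the Lipschitz envelope \<open>u\<close>, so that later constants depend on the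
  law \<open>P\<close> only through \<open>\<tau>\<close>.\<close>
locale lipschitz_losses = iid_draws S P n Z
  for S :: "'w measure" and P :: "('x \<times> 'y) measure" and n :: nat and Z :: "nat \<Rightarrow> 'w \<Rightarrow> 'x \<times> 'y" +
  fixes MX :: "'x measure" and MY :: "'y measure"
    and \<L> :: "('x \<Rightarrow> real) \<Rightarrow> 'x \<times> 'y \<Rightarrow> real" and F :: "('x \<Rightarrow> real) set"
    and u :: "'x \<times> 'y \<Rightarrow> real" and m \<tau> M :: real
  assumes sets_P: "sets P = sets (MX \<Otimes>\<^sub>M MY)"
    and F_measurable: "f \<in> F \<Longrightarrow> f \<in> borel_measurable MX"
    and F_bounded: "f \<in> F \<Longrightarrow> x \<in> space MX \<Longrightarrow> \<bar>f x\<bar> \<le> M"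
    and loss_integrable: "f \<in> F \<Longrightarrow> integrable P (\<L> f)"
    and loss_lipschitz: "f \<in> F \<Longrightarrow> g \<in> F \<Longrightarrow> z \<in> space P
      \<Longrightarrow> \<bar>\<L> f z - \<L> g z\<bar> \<le> u z * \<bar>f (fst z) - g (fst z)\<bar>"
    and u_measurable: "u \<in> borel_measurable P"
    and u_nonneg: "z \<in> space P \<Longrightarrow> 0 \<le> u z"
    and m_gt_1: "1 < m"
    and u_power_integrable: "integrable P (\<lambda>z. u z powr m)"
    and \<tau>_ge_1: "1 \<le> \<tau>"
    and u_moment: "(\<integral>z. u z powr m \<partial>P) \<le> \<tau>" "(\<integral>z. u z \<partial>P) \<le> \<tau>"
    and u_conditional_moment: "2 \<le> m \<Longrightarrow>
      AE z in P. \<bar>real_cond_exp P (vimage_algebra (space P) fst MX) (\<lambda>z. (u z)\<^sup>2) z\<bar> \<le> \<tau>"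
begin

lemma space_P: "space P = space MX \<times> space MY"
  using sets_eq_imp_space_eq[OF sets_P] by (simp add: space_pair_measure)

lemma fst_space: "z \<in> space P \<Longrightarrow> fst z \<in> space MX"
  by (auto simp: space_P)

lemma fst_measurable: "fst \<in> measurable P MX"
  by (rule fst_measurable_pair[OF sets_P])

lemma bounded_square_integrable:
  fixes d :: "'x \<Rightarrow> real"
  assumes "d \<in> borel_measurable MX" "\<And>x. x \<in> space MX \<Longrightarrow> \<bar>d x\<bar> \<le> b"
  shows "integrable P (\<lambda>z. (d (fst z))\<^sup>2)"
proof (rule P.integrable_const_bound[where B = "b\<^sup>2"])
  show "AE z in P. norm ((d (fst z))\<^sup>2) \<le> b\<^sup>2"
    using power_mono[OF assms(2), of _ 2] fst_space by (intro AE_I2) auto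
  show "(\<lambda>z. (d (fst z))\<^sup>2) \<in> borel_measurable P"
    using measurable_compose[OF fst_measurable assms(1)] by measurable
qed

lemma square_integral_le:
  fixes d :: "'x \<Rightarrow> real"
  assumes "\<And>x. x \<in> space MX \<Longrightarrow> \<bar>d x\<bar> \<le> b"
  shows "(\<integral>z. (d (fst z))\<^sup>2 \<partial>P) \<le> b\<^sup>2"
proof -
  have "(\<integral>z. (d (fst z))\<^sup>2 \<partial>P) \<le> (\<integral>z. b\<^sup>2 \<partial>P)"
    by (rule integral_mono') (use power_mono[OF assms, of _ 2] fst_space in auto)
  then show ?thesis by (simp add: P.prob_space)
qed

lemma square_integral_triangle:
  fixes f g k :: "'x \<Rightarrow> real"
  assumes "f \<in> borel_measurable MX" "g \<in> borel_measurable MX" "k \<in> borel_measurable MX"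
    and "\<And>x. x \<in> space MX \<Longrightarrow> \<bar>f x\<bar> \<le> b" "\<And>x. x \<in> space MX \<Longrightarrow> \<bar>g x\<bar> \<le> b" "\<And>x. x \<in> space MX \<Longrightarrow> \<bar>k x\<bar> \<le> b"
  shows "(\<integral>z. (f (fst z) - g (fst z))\<^sup>2 \<partial>P)
    \<le> 2 * (\<integral>z. (f (fst z) - k (fst z))\<^sup>2 \<partial>P) + 2 * (\<integral>z. (g (fst z) - k (fst z))\<^sup>2 \<partial>P)"
proof -
  have i: "integrable P (\<lambda>z. (f (fst z) - k (fst z))\<^sup>2)" "integrable P (\<lambda>z. (g (fst z) - k (fst z))\<^sup>2)"
    using bounded_square_integrable[of "\<lambda>x. f x - k x" "b + b"] bounded_square_integrable[of "\<lambda>x. g x - k x" "b + b"]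
      assms by (fastforce intro: borel_measurable_diff)+
  have "(\<integral>z. (f (fst z) - g (fst z))\<^sup>2 \<partial>P)
    \<le> (\<integral>z. 2 * (f (fst z) - k (fst z))\<^sup>2 + 2 * (g (fst z) - k (fst z))\<^sup>2 \<partial>P)"
  proof (rule integral_mono')
    fix z
    have "0 \<le> ((f (fst z) - k (fst z)) + (g (fst z) - k (fst z)))\<^sup>2" by simp
    then show "(f (fst z) - g (fst z))\<^sup>2 \<le> 2 * (f (fst z) - k (fst z))\<^sup>2 + 2 * (g (fst z) - k (fst z))\<^sup>2"
      by (simp add: power2_eq_square algebra_simps)
  qed (use i in auto)
  also have "\<dots> = 2 * (\<integral>z. (f (fst z) - k (fst z))\<^sup>2 \<partial>P) + 2 * (\<integral>z. (g (fst z) - k (fst z))\<^sup>2 \<partial>P)"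
    using i by (simp add: Bochner_Integration.integral_add)
  finally show ?thesis .
qed

lemma u_integrable: "integrable P u"
  using integrable_powr_lower[OF P.prob_space_axioms u_measurable u_nonneg u_power_integrable, of 1] m_gt_1 u_nonneg
  by (subst Bochner_Integration.integrable_cong[where g = "\<lambda>z. u z powr 1"]) auto

lemma u_square_integrable: "2 \<le> m \<Longrightarrow> integrable P (\<lambda>z. (u z)\<^sup>2)"
  using integrable_powr_lower[OF P.prob_space_axioms u_measurable u_nonneg u_power_integrable, of 2] u_nonneg
  by (subst Bochner_Integration.integrable_cong[where g = "\<lambda>z. u z powr 2"]) auto

text \<open>The two members of a link at scale \<open>h\<close> are within \<open>h + 2 * h\<close> of each other uniformly, and within
  \<open>2 * \<delta>\<close> in \<open>L\<^sup>2\<close> because both lie in a ball of radius \<open>\<delta>\<close>. The variance sees the smaller of the two.\<close>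
lemma mean_sup_dev_le_links:
  assumes Q: "finite Q" "Q \<noteq> {}" "Q \<subseteq> F \<times> F"
    and sup: "\<And>f g x. (f, g) \<in> Q \<Longrightarrow> x \<in> space MX \<Longrightarrow> \<bar>f x - g x\<bar> \<le> 3 * h"
    and L2: "\<And>f g. (f, g) \<in> Q \<Longrightarrow> (\<integral>z. (f (fst z) - g (fst z))\<^sup>2 \<partial>P) \<le> (2 * \<delta>)\<^sup>2"
    and h: "0 < h" "0 < \<delta>"
    and card: "(1 + ln (2 * real (card Q))) / real n \<le> \<Lambda> / T" "0 < T" "1 \<le> \<Lambda>"
  shows "mean_sup_dev_le ((\<lambda>(f, g) z. \<L> f z - \<L> g z) ` Q)
    (18 * \<tau> * \<Lambda> * (h * T powr (- (1 - 1 / m)) + min h \<delta> * T powr (- (1 / 2))))"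
proof -
  let ?G = "(\<lambda>(f, g) z. \<L> f z - \<L> g z) ` Q"
  have cG: "0 < card ?G" "card ?G \<le> card Q" using Q by (auto simp: card_image_le card_gt_0_iff)
  have "mean_sup_dev_le ?G (6 * \<tau> * \<Lambda> * (3 * h * T powr (- (1 - 1 / m)) + 3 * min h \<delta> * T powr (- (1 / 2))))"
  proof (rule mean_sup_dev_le_heavy_tailed[where u = u and m = m and L = "1 + ln (2 * real (card ?G))"])
    fix k z assume "k \<in> ?G" and z: "z \<in> space P"
    then obtain f g where fg: "(f, g) \<in> Q" "k = (\<lambda>z. \<L> f z - \<L> g z)" by auto
    have "\<bar>k z\<bar> \<le> u z * \<bar>f (fst z) - g (fst z)\<bar>"
      unfolding fg(2) by (rule loss_lipschitz) (use fg(1) Q(3) z in auto)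
    also have "\<dots> \<le> u z * (3 * h)"
      using sup[OF fg(1) fst_space[OF z]] u_nonneg[OF z] by (intro mult_left_mono) auto
    finally show "\<bar>k z\<bar> \<le> 3 * h * u z" by (simp add: mult_ac)
  next
    fix k assume "k \<in> ?G"
    then obtain f g where "(f, g) \<in> Q" "k = (\<lambda>z. \<L> f z - \<L> g z)" by auto
    then show "k \<in> borel_measurable P" using Q loss_integrable by (auto intro!: borel_measurable_diff)
  next
    fix k assume "k \<in> ?G" and m: "2 \<le> m"
    then obtain f g where fg: "(f, g) \<in> Q" "k = (\<lambda>z. \<L> f z - \<L> g z)" by auto
    then have FF: "f \<in> F" "g \<in> F" using Q by auto
    define d where "d x = f x - g x" for x
    have d: "d \<in> borel_measurable MX" "\<And>x. x \<in> space MX \<Longrightarrow> \<bar>d x\<bar> \<le> 3 * h"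
      using FF F_measurable sup[OF fg(1)] unfolding d_def by auto
    have ki: "integrable P (\<lambda>z. (u z * d (fst z))\<^sup>2)"
    proof (rule Bochner_Integration.integrable_bound[where f = "\<lambda>z. (3 * h)\<^sup>2 * (u z)\<^sup>2"])
      show "(\<lambda>z. (u z * d (fst z))\<^sup>2) \<in> borel_measurable P"
        using u_measurable measurable_compose[OF fst_measurable d(1)] by measurable
      show "AE z in P. norm ((u z * d (fst z))\<^sup>2) \<le> norm ((3 * h)\<^sup>2 * (u z)\<^sup>2)"
        using power_mono[OF d(2), of _ 2] fst_space
        by (intro AE_I2) (auto simp: power_mult_distrib mult.commute[of "(u _)\<^sup>2"] intro!: mult_right_mono)
    qed (use u_square_integrable[OF m] in auto)
    have "(\<integral>z. (k z)\<^sup>2 \<partial>P) \<le> (\<integral>z. (u z * d (fst z))\<^sup>2 \<partial>P)"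
    proof (rule integral_mono'[OF ki])
      fix z assume z: "z \<in> space P"
      have "\<bar>k z\<bar> \<le> \<bar>u z * d (fst z)\<bar>"
        using fg FF loss_lipschitz[OF FF z] u_nonneg[OF z] by (auto simp: abs_mult d_def)
      then show "(k z)\<^sup>2 \<le> (u z * d (fst z))\<^sup>2" by (simp add: abs_le_square_iff)
    qed auto
    also have "\<dots> \<le> \<tau> * (\<integral>z. (d (fst z))\<^sup>2 \<partial>P)"
      by (rule integral_square_le_conditional_moment[OF P.prob_space_axioms sets_P u_measurable
            u_square_integrable[OF m] u_conditional_moment[OF m] d])
    also have "\<dots> \<le> \<tau> * (3 * min h \<delta>)\<^sup>2"
    proof (rule mult_left_mono)
      have "(\<integral>z. (d (fst z))\<^sup>2 \<partial>P) \<le> (3 * h)\<^sup>2" by (rule square_integral_le[OF d(2)])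
      moreover have "(\<integral>z. (d (fst z))\<^sup>2 \<partial>P) \<le> (3 * \<delta>)\<^sup>2"
      proof -
        have "(2 * \<delta>)\<^sup>2 \<le> (3 * \<delta>)\<^sup>2" using h by (intro power_mono) auto
        then show ?thesis using L2[OF fg(1)] unfolding d_def by linarith
      qed
      ultimately show "(\<integral>z. (d (fst z))\<^sup>2 \<partial>P) \<le> (3 * min h \<delta>)\<^sup>2" by (simp add: min_def)
    qed (use \<tau>_ge_1 in simp)
    finally show "(\<integral>z. (k z)\<^sup>2 \<partial>P) \<le> \<tau> * (3 * min h \<delta>)\<^sup>2" .
  next
    have "ln (2 * real (card ?G)) \<le> ln (2 * real (card Q))" using cG by simp
    then have "(1 + ln (2 * real (card ?G))) / real n \<le> (1 + ln (2 * real (card Q))) / real n"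
      by (intro divide_right_mono) auto
    then show "(1 + ln (2 * real (card ?G))) / real n \<le> \<Lambda> / T" using card(1) by linarith
  qed (use Q h card m_gt_1 u_measurable u_nonneg u_power_integrable u_moment \<tau>_ge_1 in auto)
  moreover have "6 * \<tau> * \<Lambda> * (3 * h * T powr (- (1 - 1 / m)) + 3 * min h \<delta> * T powr (- (1 / 2)))
    = 18 * \<tau> * \<Lambda> * (h * T powr (- (1 - 1 / m)) + min h \<delta> * T powr (- (1 / 2)))"
    by (simp add: algebra_simps)
  ultimately show ?thesis by (simp only:)
qed

text \<open>The losses in \<open>B\<close> are expanded along projections onto nets at the scales \<open>hmax / 2 ^ k\<close>, cut off below at
  \<open>hmin\<close>. The coarsest projection is constantly \<open>fs\<close>. Since \<open>R\<close> bounds every link, the chain costs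
  at most its length times \<open>R\<close>, and what is left below \<open>hmin\<close> is estimated by its envelope.\<close>
lemma mean_sup_dev_le_chaining:
  assumes B: "B \<subseteq> F" "fs \<in> B"
    and L2: "\<And>f. f \<in> B \<Longrightarrow> (\<integral>z. (f (fst z) - fs (fst z))\<^sup>2 \<partial>P) \<le> \<delta>\<^sup>2" "0 < \<delta>"
    and sup: "\<And>f x. f \<in> B \<Longrightarrow> x \<in> space MX \<Longrightarrow> \<bar>f x - fs x\<bar> \<le> hmax"
    and hmin: "0 < hmin" "hmax \<le> 2 ^ J * hmin" "0 \<le> hmax"
    and t: "0 < t" "0 \<le> \<gamma>" "1 \<le> \<Lambda>"
    and nets: "\<And>h. hmin \<le> h \<Longrightarrow> h \<le> max hmax hmin \<Longrightarrow>
      \<exists>C. finite C \<and> C \<noteq> {} \<and> (\<forall>f\<in>F. \<exists>c\<in>C. \<forall>x\<in>space MX. \<bar>f x - c x\<bar> \<le> h / 2)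
        \<and> (1 + ln 2 + 2 * ln (real (card C))) / real n \<le> \<Lambda> / (t * h powr \<gamma>)"
    and R: "\<And>h. hmin \<le> h \<Longrightarrow> h \<le> max hmax hmin \<Longrightarrow>
      h * (t * h powr \<gamma>) powr (- (1 - 1 / m)) + min h \<delta> * (t * h powr \<gamma>) powr (- (1 / 2)) \<le> R"
  shows "mean_sup_dev_le ((\<lambda>f z. \<L> f z - \<L> fs z) ` B) (2 * \<tau> * hmin + real J * (18 * \<tau> * \<Lambda> * R))"
proof -
  define h where "h k = max (hmax / 2 ^ k) hmin" for k :: nat
  define T where "T k = t * h k powr \<gamma>" for k
  have h: "hmin \<le> h k" "h k \<le> max hmax hmin" "0 < h k" for k
  proof -
    have "hmax / 2 ^ k \<le> hmax" using hmin(3) by (simp add: field_simps mult_le_cancel_left1)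
    then show "hmin \<le> h k" "h k \<le> max hmax hmin" "0 < h k" using hmin by (auto simp: h_def)
  qed
  have h_anti: "h (Suc k) \<le> h k" for k
    using hmin(3) unfolding h_def by (intro max.mono) (auto simp: field_simps)
  have h_double: "h k \<le> 2 * h (Suc k)" for k
    using hmin(1) by (auto simp: h_def max_def)
  have hJ: "h J = hmin" using hmin by (simp add: h_def field_simps)
  have T0: "0 < T k" for k using t h(3)[of k] by (simp add: T_def)
  have T_anti: "T (Suc k) \<le> T k" for k
    using t h(3)[of "Suc k"] h_anti[of k] unfolding T_def by (intro mult_left_mono powr_mono2) auto
  \<comment> \<open>At level \<open>0\<close> the constant projection to \<open>fs\<close> is admissible, since \<open>h 0 \<ge> hmax\<close>; \<open>N\<close> is taken from a
    net even there, so that all levels satisfy the same entropy bound.\<close>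
  have "\<exists>\<pi> N. \<pi> ` B \<subseteq> B \<and> finite (\<pi> ` B) \<and> card (\<pi> ` B) \<le> N \<and> (\<forall>f\<in>B. \<forall>x\<in>space MX. \<bar>f x - \<pi> f x\<bar> \<le> h k)
    \<and> 1 \<le> N \<and> (1 + ln 2 + 2 * ln (real N)) / real n \<le> \<Lambda> / T k \<and> (k = 0 \<longrightarrow> (\<forall>f\<in>B. \<pi> f = fs))" for k
  proof -
    obtain C where C: "finite C" "C \<noteq> {}" "\<And>f. f \<in> F \<Longrightarrow> \<exists>c\<in>C. \<forall>x\<in>space MX. \<bar>f x - c x\<bar> \<le> h k / 2"
      "(1 + ln 2 + 2 * ln (real (card C))) / real n \<le> \<Lambda> / T k"
      using nets[OF h(1,2)[of k]] unfolding T_def by blast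
    have C1: "1 \<le> card C" using C by (simp add: Suc_leI card_gt_0_iff)
    show ?thesis
    proof (cases "k = 0")
      case True
      have "(\<lambda>_. fs) ` B = {fs}" using B by auto
      moreover have "\<bar>f x - fs x\<bar> \<le> h k" if "f \<in> B" "x \<in> space MX" for f x
        using sup[OF that] True by (simp add: h_def)
      ultimately show ?thesis using B(2) C(4) C1
        by (intro exI[of _ "\<lambda>_. fs"] exI[of _ "card C"]) simp
    next
      case False
      obtain \<pi> where "\<pi> ` B \<subseteq> B" "finite (\<pi> ` B)" "card (\<pi> ` B) \<le> card C" "\<forall>f\<in>B. \<forall>x\<in>space MX. \<bar>f x - \<pi> f x\<bar> \<le> h k"
        using projection_within[OF C(1,3) B(1)] by blast
      then show ?thesis using C C1 False by blast
    qed
  qed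
  then obtain \<pi> N where pi: "\<And>k. \<pi> k ` B \<subseteq> B" "\<And>k. finite (\<pi> k ` B)" "\<And>k. card (\<pi> k ` B) \<le> N k"
    "\<And>k f x. f \<in> B \<Longrightarrow> x \<in> space MX \<Longrightarrow> \<bar>f x - \<pi> k f x\<bar> \<le> h k" "\<And>k. 1 \<le> N k"
    "\<And>k. (1 + ln 2 + 2 * ln (real (N k))) / real n \<le> \<Lambda> / T k" "\<And>f. f \<in> B \<Longrightarrow> \<pi> 0 f = fs"
    by metis
  have piB: "\<pi> k f \<in> B" "\<pi> k f \<in> F" if "f \<in> B" for k f using pi(1)[of k] B(1) that by auto
  define Q where "Q k = (\<lambda>f. (\<pi> (Suc k) f, \<pi> k f)) ` B" for k
  have link: "mean_sup_dev_le ((\<lambda>(f, g) z. \<L> f z - \<L> g z) ` Q k) (18 * \<tau> * \<Lambda> * R)" for k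
  proof -
    have "mean_sup_dev_le ((\<lambda>(f, g) z. \<L> f z - \<L> g z) ` Q k) (18 * \<tau> * \<Lambda> *
      (h (Suc k) * T (Suc k) powr (- (1 - 1 / m)) + min (h (Suc k)) \<delta> * T (Suc k) powr (- (1 / 2))))"
    proof (rule mean_sup_dev_le_links)
      have sub: "Q k \<subseteq> \<pi> (Suc k) ` B \<times> \<pi> k ` B" by (auto simp: Q_def)
      show fin: "finite (Q k)" using sub pi(2) finite_subset by blast
      show ne: "Q k \<noteq> {}" using B by (auto simp: Q_def)
      show "Q k \<subseteq> F \<times> F" using piB by (auto simp: Q_def)
      have "card (Q k) \<le> card (\<pi> (Suc k) ` B \<times> \<pi> k ` B)"
        by (rule card_mono[OF _ sub]) (use pi(2) in auto)
      also have "\<dots> \<le> N (Suc k) * N k" unfolding card_cartesian_product by (intro mult_mono pi) auto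
      finally have "2 * real (card (Q k)) \<le> 2 * (real (N (Suc k)) * real (N k))"
        by (simp flip: of_nat_mult)
      moreover have "0 < card (Q k)" using fin ne by (simp add: card_gt_0_iff)
      ultimately have "ln (2 * real (card (Q k))) \<le> ln (2 * (real (N (Suc k)) * real (N k)))" by simp
      also have "\<dots> = ln 2 + ln (real (N (Suc k))) + ln (real (N k))"
      proof -
        have "0 < N (Suc k)" "0 < N k" using pi(5)[of k] pi(5)[of "Suc k"] by auto
        then show ?thesis by (simp add: ln_mult)
      qed
      finally have "1 + ln (2 * real (card (Q k))) \<le>
        ((1 + ln 2 + 2 * ln (real (N (Suc k)))) + (1 + ln 2 + 2 * ln (real (N k)))) / 2" by (simp add: add_divide_distrib)
      then have "(1 + ln (2 * real (card (Q k)))) / real n \<le>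
        ((1 + ln 2 + 2 * ln (real (N (Suc k)))) + (1 + ln 2 + 2 * ln (real (N k)))) / 2 / real n"
        by (rule divide_right_mono) simp
      also have "\<dots> = ((1 + ln 2 + 2 * ln (real (N (Suc k)))) / real n + (1 + ln 2 + 2 * ln (real (N k))) / real n) / 2"
        by (simp add: add_divide_distrib)
      also have "\<dots> \<le> (\<Lambda> / T (Suc k) + \<Lambda> / T k) / 2" by (intro divide_right_mono add_mono pi(6)) simp
      also have "\<dots> \<le> \<Lambda> / T (Suc k)"
      proof -
        have mean: "(x + y) / 2 \<le> x" if "y \<le> x" for x y :: real using that by simp
        show ?thesis using T_anti[of k] T0 t by (intro mean divide_left_mono) auto
      qed
      finally show "(1 + ln (2 * real (card (Q k)))) / real n \<le> \<Lambda> / T (Suc k)" .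
    next
      fix f g x assume "(f, g) \<in> Q k" and x: "x \<in> space MX"
      then obtain b where b: "b \<in> B" "f = \<pi> (Suc k) b" "g = \<pi> k b" by (auto simp: Q_def)
      then show "\<bar>f x - g x\<bar> \<le> 3 * h (Suc k)"
        unfolding b(2,3) using pi(4)[OF b(1) x, of k] pi(4)[OF b(1) x, of "Suc k"] h_double[of k] by linarith
    next
      fix f g assume "(f, g) \<in> Q k"
      then have fg: "f \<in> B" "g \<in> B" using pi(1) by (auto simp: Q_def)
      have "(\<integral>z. (f (fst z) - g (fst z))\<^sup>2 \<partial>P)
        \<le> 2 * (\<integral>z. (f (fst z) - fs (fst z))\<^sup>2 \<partial>P) + 2 * (\<integral>z. (g (fst z) - fs (fst z))\<^sup>2 \<partial>P)"
        by (rule square_integral_triangle[where b = M]) (use fg B F_measurable F_bounded in auto)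
      also have "\<dots> \<le> (2 * \<delta>)\<^sup>2" using L2(1)[OF fg(1)] L2(1)[OF fg(2)] by (simp add: power_mult_distrib)
      finally show "(\<integral>z. (f (fst z) - g (fst z))\<^sup>2 \<partial>P) \<le> (2 * \<delta>)\<^sup>2" .
    qed (use h T0 t L2 in auto)
    then show ?thesis
    proof (rule mean_sup_dev_le_mono)
      show "18 * \<tau> * \<Lambda> * (h (Suc k) * T (Suc k) powr (- (1 - 1 / m)) + min (h (Suc k)) \<delta> * T (Suc k) powr (- (1 / 2)))
        \<le> 18 * \<tau> * \<Lambda> * R"
        using R[OF h(1,2)[of "Suc k"]] \<tau>_ge_1 t unfolding T_def by (intro mult_left_mono) auto
    qed
  qed
  have int: "integrable P (\<lambda>z. \<L> f z - \<L> g z)" if "f \<in> F" "g \<in> F" for f g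
    using loss_integrable that by auto
  have chain: "mean_sup_dev_le ((\<lambda>f z. \<L> (\<pi> J f) z - \<L> fs z) ` B) (\<Sum>k<J. 18 * \<tau> * \<Lambda> * R)"
  proof (rule mean_sup_dev_le_sum[where G = "\<lambda>k. (\<lambda>(f, g) z. \<L> f z - \<L> g z) ` Q k"])
    fix k assume "k \<in> (\<lambda>f z. \<L> (\<pi> J f) z - \<L> fs z) ` B"
    then obtain f where f: "f \<in> B" "k = (\<lambda>z. \<L> (\<pi> J f) z - \<L> fs z)" by blast
    have "k = (\<lambda>z. \<Sum>i<J. \<L> (\<pi> (Suc i) f) z - \<L> (\<pi> i f) z)"
      unfolding f(2)
    proof (rule ext)
      fix z
      show "\<L> (\<pi> J f) z - \<L> fs z = (\<Sum>i<J. \<L> (\<pi> (Suc i) f) z - \<L> (\<pi> i f) z)"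
        using sum_lessThan_telescope[of "\<lambda>i. \<L> (\<pi> i f) z" J] pi(7)[OF f(1)] by simp
    qed
    moreover have "(\<lambda>z. \<L> (\<pi> (Suc i) f) z - \<L> (\<pi> i f) z) \<in> (\<lambda>(f, g) z. \<L> f z - \<L> g z) ` Q i" for i
      using f(1) by (force simp: Q_def image_def)
    ultimately show "\<exists>g. (\<forall>i\<in>{..<J}. g i \<in> (\<lambda>(f, g) z. \<L> f z - \<L> g z) ` Q i \<and> integrable P (g i))
        \<and> k = (\<lambda>z. \<Sum>i\<in>{..<J}. g i z)"
      using int piB[OF f(1)] by (intro exI[of _ "\<lambda>i z. \<L> (\<pi> (Suc i) f) z - \<L> (\<pi> i f) z"]) auto
  qed (use link in auto)
  have "mean_sup_dev_le ((\<lambda>f z. \<L> f z - \<L> (\<pi> J f) z) ` B) (2 * (\<integral>z. u z * hmin \<partial>P))"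
  proof (rule mean_sup_dev_le_envelope)
    fix k z assume "k \<in> (\<lambda>f z. \<L> f z - \<L> (\<pi> J f) z) ` B" and z: "z \<in> space P"
    then obtain f where f: "f \<in> B" "k = (\<lambda>z. \<L> f z - \<L> (\<pi> J f) z)" by blast
    have "\<bar>k z\<bar> \<le> u z * \<bar>f (fst z) - \<pi> J f (fst z)\<bar>"
      unfolding f(2) by (rule loss_lipschitz) (use f B piB z in auto)
    also have "\<dots> \<le> u z * hmin"
      using pi(4)[OF f(1) fst_space[OF z], of J] u_nonneg[OF z] hJ by (intro mult_left_mono) auto
    finally show "\<bar>k z\<bar> \<le> u z * hmin" .
  qed (use u_integrable in auto)
  then have rest: "mean_sup_dev_le ((\<lambda>f z. \<L> f z - \<L> (\<pi> J f) z) ` B) (2 * \<tau> * hmin)"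
  proof (rule mean_sup_dev_le_mono)
    show "2 * (\<integral>z. u z * hmin \<partial>P) \<le> 2 * \<tau> * hmin" using u_moment(2) hmin by simp
  qed
  have "mean_sup_dev_le ((\<lambda>f z. \<L> f z - \<L> fs z) ` B) (2 * \<tau> * hmin + (\<Sum>k<J. 18 * \<tau> * \<Lambda> * R))"
  proof (rule mean_sup_dev_le_add[OF rest chain])
    fix k assume "k \<in> (\<lambda>f z. \<L> f z - \<L> fs z) ` B"
    then obtain f where f: "f \<in> B" "k = (\<lambda>z. \<L> f z - \<L> fs z)" by blast
    then show "\<exists>f1\<in>(\<lambda>f z. \<L> f z - \<L> (\<pi> J f) z) ` B. \<exists>f2\<in>(\<lambda>f z. \<L> (\<pi> J f) z - \<L> fs z) ` B.
        integrable P f1 \<and> integrable P f2 \<and> k = (\<lambda>z. f1 z + f2 z)"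
      using int piB[OF f(1)] B
      by (intro bexI[of _ "\<lambda>z. \<L> f z - \<L> (\<pi> J f) z"] bexI[of _ "\<lambda>z. \<L> (\<pi> J f) z - \<L> fs z"]) auto
  qed
  then show ?thesis by simp
qed

end

section \<open>Localization and the error of the empirical minimizer\<close>

context lipschitz_losses begin

lemma L2_square: "(L2_norm_fst P g)\<^sup>2 = (\<integral>z. (g (fst z))\<^sup>2 \<partial>P)"
  unfolding L2_norm_fst_def by (rule real_sqrt_pow2) (rule Bochner_Integration.integral_nonneg, simp)

lemma L2_nonneg: "0 \<le> L2_norm_fst P g"
  unfolding L2_norm_fst_def by (intro real_sqrt_ge_zero Bochner_Integration.integral_nonneg) simp

lemma L2_le_sup:
  assumes "\<And>x. x \<in> space MX \<Longrightarrow> \<bar>g x\<bar> \<le> b" "0 \<le> b"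
  shows "L2_norm_fst P g \<le> b"
  using square_integral_le[OF assms(1)] assms(2) unfolding L2_norm_fst_def
  by (intro real_le_lsqrt) auto

text \<open>Every link of the chain from \<open>min (A * \<delta>\<^sup>s) (2 * M)\<close> down to the finest scale costs at most a multiple
  of \<open>\<delta> * e\<close>, and so does the remainder below that scale. Linearity in \<open>\<delta>\<close> is what makes
  peeling over dyadic radii lose only the number of shells.\<close>
lemma mean_sup_dev_le_local:
  assumes fs: "fs \<in> F" and M: "0 < M" and D: "1 \<le> D" "D \<le> real n"
    and par: "0 \<le> \<gamma>" "0 \<le> s" "s \<le> 1" "0 < C0" "1 \<le> U0" "0 \<le> a0" "1 \<le> A"
    and e: "(real n / D) powr (- entropy_exponent \<gamma>) \<le> e"
      "(real n / D) powr (- inverse ((2 - s) / (1 - 1 / m) + s * \<gamma>)) \<le> e" "e \<le> \<delta>"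
    and env: "\<And>f x. f \<in> F \<Longrightarrow> x \<in> space MX \<Longrightarrow>
      \<bar>f x - fs x\<bar> \<le> A * rpow (L2_norm_fst P (\<lambda>x. f x - fs x)) s"
    and entropy: "\<And>h. 0 < h \<Longrightarrow> log_covering_le h F (unif_dist (space MX))
       (C0 * D * h powr (- \<gamma>) * log_plus (U0 / h) powr a0)"
    and J: "2 * M * real n \<le> 2 ^ J"
    and \<Lambda>: "\<Lambda> = (2 * (2 * M + 1) powr \<gamma> + 2 * (C0 * 2 powr \<gamma> * (1 + ln (2 * U0)) powr a0)) * log_plus (real n) powr a0"
  shows "mean_sup_dev_le ((\<lambda>f z. \<L> f z - \<L> fs z) ` {f \<in> F. L2_norm_fst P (\<lambda>x. f x - fs x) \<le> \<delta>})
    (38 * \<tau> * \<Lambda> * A * (real J + 1) * (\<delta> * e))"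
proof -
  define t where "t = real n / D"
  have n0: "0 < real n" using n_pos by simp
  have t: "1 \<le> t" "t \<le> real n" using D n0 by (auto simp: t_def field_simps)
  define hmin where "hmin = finest_scale \<gamma> t"
  \<comment> \<open>The cap \<open>2 * M\<close> keeps the largest scale bounded for arbitrarily large \<open>\<delta>\<close>, as needed for the
    entropy bound and for the length \<open>J\<close> of the chain.\<close>
  define h0 where "h0 = min (A * \<delta> powr s) (2 * M)"
  note fin = finest_scale[OF t(1) par(1), folded hmin_def]
  note prod = finest_scale_le_product[OF t(1) par(1) e(1,3)[folded t_def], folded hmin_def]
  have \<delta>0: "0 < \<delta>" using prod e by linarith
  have de: "0 < \<delta> * e" using \<delta>0 prod by simp
  have h_n: "1 / real n \<le> hmin"
    using fin(3) t divide_left_mono[of t "real n" 1] n0 by simp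
  have lp: "1 \<le> log_plus (real n) powr a0" using log_plus_ge_1 par by (simp add: ge_one_powr_ge_zero)
  have \<Lambda>1: "1 \<le> \<Lambda>"
  proof -
    have "1 \<le> (2 * M + 1) powr \<gamma>" using M par by (intro ge_one_powr_ge_zero) auto
    moreover have "0 \<le> C0 * 2 powr \<gamma> * (1 + ln (2 * U0)) powr a0" using par by simp
    ultimately have "1 * 1 \<le> \<Lambda>" unfolding \<Lambda> using lp by (intro mult_mono) linarith+
    then show ?thesis by simp
  qed
  have h0: "0 \<le> h0" "h0 \<le> A * \<delta> powr s" "h0 \<le> 2 * M" using M par by (auto simp: h0_def)
  have q: "0 < 1 - 1 / m" "1 - 1 / m < 1" using m_gt_1 by auto
  have "mean_sup_dev_le ((\<lambda>f z. \<L> f z - \<L> fs z) ` {f \<in> F. L2_norm_fst P (\<lambda>x. f x - fs x) \<le> \<delta>})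
    (2 * \<tau> * hmin + real J * (18 * \<tau> * \<Lambda> * (2 * (A * (\<delta> * e)))))"
  proof (rule mean_sup_dev_le_chaining[where hmax = h0 and \<delta> = \<delta> and t = t and \<gamma> = \<gamma>])
    show "fs \<in> {f \<in> F. L2_norm_fst P (\<lambda>x. f x - fs x) \<le> \<delta>}"
      using fs \<delta>0 by (simp add: L2_norm_fst_def)
  next
    fix f assume "f \<in> {f \<in> F. L2_norm_fst P (\<lambda>x. f x - fs x) \<le> \<delta>}"
    then show "(\<integral>z. (f (fst z) - fs (fst z))\<^sup>2 \<partial>P) \<le> \<delta>\<^sup>2"
      using power_mono[of "L2_norm_fst P (\<lambda>x. f x - fs x)" \<delta> 2] L2_nonneg by (simp add: L2_square)
  next
    fix f x assume f: "f \<in> {f \<in> F. L2_norm_fst P (\<lambda>x. f x - fs x) \<le> \<delta>}" and x: "x \<in> space MX"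
    have "\<bar>f x - fs x\<bar> \<le> A * rpow (L2_norm_fst P (\<lambda>x. f x - fs x)) s" using env f x by auto
    also have "\<dots> \<le> A * \<delta> powr s"
      using rpow_le_powr[OF L2_nonneg _ \<delta>0 par(2)] f par by (intro mult_left_mono) auto
    finally have "\<bar>f x - fs x\<bar> \<le> A * \<delta> powr s" .
    moreover have "\<bar>f x - fs x\<bar> \<le> 2 * M" using F_bounded[of f x] F_bounded[of fs x] f fs x by auto
    ultimately show "\<bar>f x - fs x\<bar> \<le> h0" by (simp add: h0_def)
  next
    have "h0 * real n \<le> 2 ^ J" by (rule order_trans[OF mult_right_mono[OF h0(3)] J]) simp
    then have "h0 \<le> 2 ^ J / real n" using n0 by (simp add: field_simps)
    also have "\<dots> \<le> 2 ^ J * hmin" using mult_left_mono[OF h_n, of "2 ^ J"] by simp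
    finally show "h0 \<le> 2 ^ J * hmin" .
  next
    fix h assume h: "hmin \<le> h" "h \<le> max h0 hmin"
    have h_pos: "0 < h" using h fin(1) by linarith
    obtain C where C: "finite C" "C \<subseteq> F" "C \<noteq> {}" "\<And>f. f \<in> F \<Longrightarrow> \<exists>c\<in>C. unif_dist (space MX) f c \<le> h / 2"
      "ln (real (card C)) \<le> C0 * D * (h / 2) powr (- \<gamma>) * log_plus (U0 / (h / 2)) powr a0"
      using log_covering_le_net[OF entropy[of "h / 2"]] h_pos fs by auto
    have "1 + ln 2 + 2 * ln (real (card C)) \<le> 1 + ln 2 + 2 * (C0 * D * (h / 2) powr (- \<gamma>) * log_plus (U0 / (h / 2)) powr a0)"
      using C(5) by linarith
    also have "\<dots> \<le> \<Lambda> * (D * h powr (- \<gamma>))"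
      unfolding \<Lambda> by (rule entropy_at_half_scale_le) (use h h_n h0 fin(2) M n_pos D par in auto)
    finally have "(1 + ln 2 + 2 * ln (real (card C))) / real n \<le> \<Lambda> * (D * h powr (- \<gamma>)) / real n"
      by (rule divide_right_mono) simp
    also have "\<dots> = \<Lambda> / (t * h powr \<gamma>)"
      using h_pos D n0 by (simp add: t_def powr_minus field_simps)
    finally have "(1 + ln 2 + 2 * ln (real (card C))) / real n \<le> \<Lambda> / (t * h powr \<gamma>)" .
    moreover have "\<exists>c\<in>C. \<forall>x\<in>space MX. \<bar>f x - c x\<bar> \<le> h / 2" if "f \<in> F" for f
      using C(4)[OF that] unif_dist_pointwise[of "space MX" f _ "h / 2" _ M] F_bounded that C(2) by blast
    ultimately show "\<exists>C. finite C \<and> C \<noteq> {} \<and> (\<forall>f\<in>F. \<exists>c\<in>C. \<forall>x\<in>space MX. \<bar>f x - c x\<bar> \<le> h / 2)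
        \<and> (1 + ln 2 + 2 * ln (real (card C))) / real n \<le> \<Lambda> / (t * h powr \<gamma>)"
      using C(1,3) by blast
  next
    fix h assume h: "hmin \<le> h" "h \<le> max h0 hmin"
    have "h * (t * h powr \<gamma>) powr (- (1 - 1 / m)) \<le> A * (\<delta> * e)"
      by (rule heavy_tail_scale_le[OF t(1) par(1) q par(2,3,7) e(1,2)[folded t_def] e(3)])
         (use h h0 in \<open>auto simp: hmin_def\<close>)
    moreover have "min h \<delta> * (t * h powr \<gamma>) powr (- (1 / 2)) \<le> \<delta> * e"
      by (rule gaussian_scale_le[OF t(1) par(1) e(1)[folded t_def] e(3)]) (use h in \<open>simp add: hmin_def\<close>)
    moreover have "1 * (\<delta> * e) \<le> A * (\<delta> * e)" using par de by (intro mult_right_mono) auto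
    ultimately show "h * (t * h powr \<gamma>) powr (- (1 - 1 / m)) + min h \<delta> * (t * h powr \<gamma>) powr (- (1 / 2))
      \<le> 2 * (A * (\<delta> * e))" by linarith
  qed (use \<delta>0 fin h0 t par \<Lambda>1 in auto)
  then show ?thesis
  proof (rule mean_sup_dev_le_mono)
    have "\<tau> * 1 \<le> \<tau> * (\<Lambda> * A)" using \<tau>_ge_1 \<Lambda>1 par mult_mono[of 1 \<Lambda> 1 A] by (intro mult_left_mono) auto
    then have "2 * \<tau> * hmin \<le> 2 * (\<tau> * (\<Lambda> * A)) * (\<delta> * e)"
      using prod(1) fin(1) \<tau>_ge_1 by (intro mult_mono) auto
    also have "\<dots> \<le> 2 * (\<tau> * (\<Lambda> * A)) * (\<delta> * e) * (real J + 1)"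
      using \<tau>_ge_1 \<Lambda>1 par \<delta>0 prod(3) by (simp add: mult_le_cancel_left1 mult_less_0_iff)
    finally have 1: "2 * \<tau> * hmin \<le> 2 * (\<tau> * (\<Lambda> * A)) * (\<delta> * e) * (real J + 1)" .
    have "0 \<le> \<tau> * (\<Lambda> * A) * (\<delta> * e)" using \<tau>_ge_1 \<Lambda>1 par de by simp
    then have "real J * (18 * \<tau> * \<Lambda> * (2 * (A * (\<delta> * e)))) \<le> 36 * (\<tau> * (\<Lambda> * A)) * (\<delta> * e) * (real J + 1)"
      by (simp add: algebra_simps)
    with 1 show "2 * \<tau> * hmin + real J * (18 * \<tau> * \<Lambda> * (2 * (A * (\<delta> * e))))
      \<le> 38 * \<tau> * \<Lambda> * A * (real J + 1) * (\<delta> * e)" by (simp add: algebra_simps)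
  qed
qed

text \<open>If the distance of \<open>fhat\<close> to \<open>fs\<close> is at most \<open>2 ^ j * e\<close>, then minimality makes the empirical average of
  \<open>\<ell>(fhat) - \<ell>(fs)\<close> nonpositive, so its mean is at most the majorant \<open>W j\<close> of the deviations over that
  ball; curvature turns this into a quadratic bound on the distance, to which \<open>peeling\<close> applies. As
  the expectation of \<open>W j\<close> is at most \<open>b * (2 ^ j * e) * e\<close>, every shell contributes the same multiple
  of \<open>e\<close>.\<close>
lemma empirical_minimizer_L2_error:
  fixes fhat :: "'w \<Rightarrow> 'x \<Rightarrow> real" and f0 :: "'x \<Rightarrow> real"
  assumes f0: "f0 \<in> borel_measurable MX" "\<And>x. x \<in> space MX \<Longrightarrow> \<bar>f0 x\<bar> \<le> M" and M: "0 < M"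
    and c: "0 < c1" "0 \<le> c2"
    and curvature: "\<And>f. f \<in> F \<Longrightarrow> c1 * (L2_norm_fst P (\<lambda>x. f x - f0 x))\<^sup>2 \<le> (\<integral>z. \<L> f z \<partial>P) - \<rho>"
      "\<And>f. f \<in> F \<Longrightarrow> (\<integral>z. \<L> f z \<partial>P) - \<rho> \<le> c2 * (L2_norm_fst P (\<lambda>x. f x - f0 x))\<^sup>2"
    and fhat: "\<And>\<omega>. \<omega> \<in> space S \<Longrightarrow> fhat \<omega> \<in> F"
      "\<And>\<omega> f. \<omega> \<in> space S \<Longrightarrow> f \<in> F \<Longrightarrow> (\<Sum>i=1..n. \<L> (fhat \<omega>) (Z i \<omega>)) \<le> (\<Sum>i=1..n. \<L> f (Z i \<omega>))"
    and fs: "fs \<in> F" "L2_norm_fst P (\<lambda>x. fs x - f0 x) \<le> e"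
    and e: "0 < e" "2 * M \<le> 2 ^ J * e"
    and local: "\<And>\<delta>. e \<le> \<delta> \<Longrightarrow> mean_sup_dev_le
      ((\<lambda>f z. \<L> f z - \<L> fs z) ` {f \<in> F. L2_norm_fst P (\<lambda>x. f x - fs x) \<le> \<delta>}) (b * (\<delta> * e))"
  shows "(\<integral>\<omega>. L2_norm_fst P (\<lambda>x. fhat \<omega> x - f0 x) \<partial>S)
    \<le> (2 * (2 + 2 * (2 * c2 / c1 + 2)) + 8 / c1 * ((real J + 1) * b)) * e"
proof -
  define B where "B j = (\<lambda>f z. \<L> f z - \<L> fs z) ` {f \<in> F. L2_norm_fst P (\<lambda>x. f x - fs x) \<le> 2 ^ j * e}" for j :: nat
  have "\<exists>W. integrable S W \<and> (\<integral>\<omega>. W \<omega> \<partial>S) \<le> b * (2 ^ j * e * e) \<and> (\<forall>\<omega>\<in>space S. \<forall>g\<in>B j. \<bar>dev g \<omega>\<bar> \<le> W \<omega>)" for j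
    using local[of "2 ^ j * e"] e(1) unfolding mean_sup_dev_le_def B_def by (simp add: mult_le_cancel_right1)
  then obtain W where W: "\<And>j. integrable S (W j)" "\<And>j. (\<integral>\<omega>. W j \<omega> \<partial>S) \<le> b * (2 ^ j * e * e)"
    "\<And>j \<omega> g. \<omega> \<in> space S \<Longrightarrow> g \<in> B j \<Longrightarrow> \<bar>dev g \<omega>\<bar> \<le> W j \<omega>"
    by metis
  define \<alpha> where "\<alpha> = 2 / c1"
  define \<beta> where "\<beta> = 2 * c2 / c1 + 2"
  have ab: "0 \<le> \<alpha>" "0 \<le> \<beta>" using c by (auto simp: \<alpha>_def \<beta>_def)
  have fsB: "fs \<in> {f \<in> F. L2_norm_fst P (\<lambda>x. f x - fs x) \<le> 2 ^ j * e}" for j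
    using fs e by (simp add: L2_norm_fst_def)
  have W0: "0 \<le> W j \<omega>" if "\<omega> \<in> space S" for j \<omega>
    using W(3)[OF that, of "\<lambda>z. \<L> fs z - \<L> fs z" j] fsB[of j] unfolding B_def by fastforce
  have triangle: "(L2_norm_fst P (\<lambda>x. f x - g x))\<^sup>2
    \<le> 2 * (L2_norm_fst P (\<lambda>x. f x - k x))\<^sup>2 + 2 * (L2_norm_fst P (\<lambda>x. g x - k x))\<^sup>2"
    if "f \<in> F \<union> {f0}" "g \<in> F \<union> {f0}" "k \<in> F \<union> {f0}" for f g k
    unfolding L2_square
    by (rule square_integral_triangle[where b = M]) (use that f0 F_measurable F_bounded in auto)
  have L2_sym: "L2_norm_fst P (\<lambda>x. f x - g x) = L2_norm_fst P (\<lambda>x. g x - f x)" for f g :: "'x \<Rightarrow> real"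
    unfolding L2_norm_fst_def by (simp add: power2_commute)
  have fs2: "(L2_norm_fst P (\<lambda>x. fs x - f0 x))\<^sup>2 \<le> e\<^sup>2" using fs(2) L2_nonneg by (intro power_mono) auto
  define H where "H \<omega> = 2 * ((2 + 2 * \<beta>) * e + (\<Sum>j\<le>J. 2 * \<alpha> * (W j \<omega> / (2 ^ j * e))))" for \<omega>
  have main: "L2_norm_fst P (\<lambda>x. fhat \<omega> x - f0 x) \<le> H \<omega>" if \<omega>: "\<omega> \<in> space S" for \<omega>
  proof -
    define r where "r = L2_norm_fst P (\<lambda>x. fhat \<omega> x - fs x)"
    define r0 where "r0 = L2_norm_fst P (\<lambda>x. fhat \<omega> x - f0 x)"
    note fh = fhat(1)[OF \<omega>]
    have r_pos: "0 \<le> r" by (simp add: r_def L2_nonneg)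
    have "r \<le> (1 + 2 * \<beta>) * e + (\<Sum>j\<le>J. 2 * \<alpha> * (W j \<omega> / (2 ^ j * e)))"
    proof (rule peeling[OF e(1) ab])
      have "\<bar>fhat \<omega> x - fs x\<bar> \<le> 2 * M" if "x \<in> space MX" for x
        using F_bounded[OF fh that] F_bounded[OF fs(1) that] by linarith
      then have "r \<le> 2 * M" unfolding r_def using M by (intro L2_le_sup) auto
      then show "r \<le> 2 ^ J * e" using e(2) by linarith
    next
      fix j assume rj: "r \<le> 2 ^ j * e"
      have "(\<lambda>z. \<L> (fhat \<omega>) z - \<L> fs z) \<in> B j" using fh rj by (auto simp: B_def r_def)
      then have "- dev (\<lambda>z. \<L> (fhat \<omega>) z - \<L> fs z) \<omega> \<le> W j \<omega>" using W(3)[OF \<omega>] by fastforce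
      moreover have "(\<integral>z. \<L> (fhat \<omega>) z \<partial>P) - (\<integral>z. \<L> fs z \<partial>P) \<le> - dev (\<lambda>z. \<L> (fhat \<omega>) z - \<L> fs z) \<omega>"
      proof -
        have "(\<Sum>i=1..n. \<L> (fhat \<omega>) (Z i \<omega>) - \<L> fs (Z i \<omega>)) / real n \<le> 0"
          using fhat(2)[OF \<omega> fs(1)] by (intro divide_nonpos_nonneg) (auto simp: sum_subtractf)
        then show ?thesis unfolding dev_def using loss_integrable[OF fh] loss_integrable[OF fs(1)] by simp
      qed
      ultimately have "c1 * r0\<^sup>2 \<le> W j \<omega> + c2 * (L2_norm_fst P (\<lambda>x. fs x - f0 x))\<^sup>2"
        using curvature(1)[OF fh] curvature(2)[OF fs(1)] unfolding r0_def by linarith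
      also have "\<dots> \<le> W j \<omega> + c2 * e\<^sup>2" using fs2 c by (intro add_left_mono mult_left_mono) auto
      finally have "r0\<^sup>2 \<le> (W j \<omega> + c2 * e\<^sup>2) / c1" using c by (simp add: field_simps)
      moreover have "r\<^sup>2 \<le> 2 * r0\<^sup>2 + 2 * e\<^sup>2"
        using triangle[of "fhat \<omega>" fs f0] fh fs fs2 unfolding r_def r0_def by auto
      ultimately have "r\<^sup>2 \<le> 2 * ((W j \<omega> + c2 * e\<^sup>2) / c1) + 2 * e\<^sup>2" by argo
      also have "\<dots> = \<alpha> * W j \<omega> + \<beta> * e\<^sup>2"
        using c(1) by (simp add: \<alpha>_def \<beta>_def field_simps)
      finally show "r\<^sup>2 \<le> \<alpha> * W j \<omega> + \<beta> * e\<^sup>2" .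
    qed (use W0[OF \<omega>] in auto)
    moreover have "r0 \<le> 2 * (r + e)"
    proof (rule power2_le_imp_le)
      have "r0\<^sup>2 \<le> 2 * r\<^sup>2 + 2 * e\<^sup>2"
        using triangle[of "fhat \<omega>" f0 fs] fh fs fs2 L2_sym[of f0 fs] unfolding r_def r0_def by auto
      also have "\<dots> \<le> (2 * (r + e))\<^sup>2" using r_pos e by (simp add: power2_eq_square algebra_simps)
      finally show "r0\<^sup>2 \<le> (2 * (r + e))\<^sup>2" .
    qed (use r_pos e in auto)
    ultimately show ?thesis unfolding H_def r0_def[symmetric] by (simp add: algebra_simps)
  qed
  have Hi: "integrable S H" unfolding H_def using W(1) by simp
  have "(\<integral>\<omega>. L2_norm_fst P (\<lambda>x. fhat \<omega> x - f0 x) \<partial>S) \<le> (\<integral>\<omega>. H \<omega> \<partial>S)"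
  proof (cases "integrable S (\<lambda>\<omega>. L2_norm_fst P (\<lambda>x. fhat \<omega> x - f0 x))")
    case True
    then show ?thesis using Hi main by (intro integral_mono) auto
  next
    case False
    have "0 \<le> (\<integral>\<omega>. H \<omega> \<partial>S)"
      using main L2_nonneg by (intro integral_nonneg_AE AE_I2) (meson order_trans)
    then show ?thesis using False by (simp add: not_integrable_integral_eq)
  qed
  also have "\<dots> = 2 * ((2 + 2 * \<beta>) * e + (\<Sum>j\<le>J. 2 * \<alpha> * ((\<integral>\<omega>. W j \<omega> \<partial>S) / (2 ^ j * e))))"
    unfolding H_def using W(1) by (simp add: S.prob_space Bochner_Integration.integral_sum)
  also have "\<dots> \<le> 2 * ((2 + 2 * \<beta>) * e + (\<Sum>j\<le>J. 2 * \<alpha> * (b * e)))"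
  proof (intro mult_left_mono add_left_mono sum_mono)
    fix j
    have "(\<integral>\<omega>. W j \<omega> \<partial>S) / (2 ^ j * e) \<le> b * (2 ^ j * e * e) / (2 ^ j * e)"
      using W(2) e by (intro divide_right_mono) auto
    then show "(\<integral>\<omega>. W j \<omega> \<partial>S) / (2 ^ j * e) \<le> b * e" using e by simp
  qed (use ab in auto)
  also have "\<dots> = (2 * (2 + 2 * (2 * c2 / c1 + 2)) + 8 / c1 * ((real J + 1) * b)) * e"
    using c by (simp add: \<alpha>_def \<beta>_def algebra_simps)
  finally show ?thesis .
qed

end

section \<open>The convergence rate\<close>

text \<open>The envelope of a class with one member is that member, so the envelope condition compares the uniform
  norm of each single difference with its \<open>L\<^sup>2\<close> norm.\<close>
lemma sup_le_L2_power:
  assumes B3: "\<And>G. G \<noteq> {} \<Longrightarrow> G \<subseteq> (\<lambda>f x. f x - fs x) ` F \<Longrightarrow>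
       unif_norm S (envelope G) \<le> C1 * rpow (SUP g\<in>G. L2_norm_fst P g) s"
    and f: "f \<in> F" "fs \<in> F" and bdd: "\<And>f x. f \<in> F \<Longrightarrow> x \<in> S \<Longrightarrow> \<bar>f x\<bar> \<le> M" and x: "x \<in> S"
  shows "\<bar>f x - fs x\<bar> \<le> max C1 1 * rpow (L2_norm_fst P (\<lambda>x. f x - fs x)) s"
proof -
  let ?g = "\<lambda>x. f x - fs x"
  have "unif_norm S (envelope {?g}) \<le> C1 * rpow (L2_norm_fst P ?g) s"
    using B3[of "{?g}"] f by auto
  also have "\<dots> \<le> max C1 1 * rpow (L2_norm_fst P ?g) s"
    by (intro mult_right_mono) (auto simp: rpow_def)
  finally have 1: "(SUP x\<in>S. \<bar>?g x\<bar>) \<le> max C1 1 * rpow (L2_norm_fst P ?g) s"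
    by (simp add: unif_norm_def envelope_def)
  have "bdd_above ((\<lambda>x. \<bar>?g x\<bar>) ` S)"
  proof (rule bdd_aboveI2[where M = "M + M"])
    show "\<bar>?g x\<bar> \<le> M + M" if "x \<in> S" for x using bdd[OF f(1) that] bdd[OF f(2) that] by linarith
  qed
  then have "\<bar>?g x\<bar> \<le> (SUP x\<in>S. \<bar>?g x\<bar>)" using x by (rule cSUP_upper[rotated])
  then show ?thesis using 1 by linarith
qed

text \<open>The measures \<open>P\<close> and \<open>MX \<Otimes>\<^sub>M MY\<close> have the same measurable sets, so either serves as the target space
  of the sample.\<close>
lemma iid_sample_imp_iid_draws:
  assumes "iid_sample \<Omega> MX MY P n X Y" "1 \<le> n" "prob_space P" "sets P = sets (MX \<Otimes>\<^sub>M MY)"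
  shows "iid_draws \<Omega> P n (\<lambda>i \<omega>. (X i \<omega>, Y i \<omega>))"
proof -
  interpret S: prob_space \<Omega> using assms(1) by (simp add: iid_sample_def)
  interpret P: prob_space P by fact
  have ind: "S.indep_vars (\<lambda>_. MX \<Otimes>\<^sub>M MY) (\<lambda>i \<omega>. (X i \<omega>, Y i \<omega>)) {1..n}"
    and law: "\<And>i. i \<in> {1..n} \<Longrightarrow> distr \<Omega> (MX \<Otimes>\<^sub>M MY) (\<lambda>\<omega>. (X i \<omega>, Y i \<omega>)) = P"
    using assms(1) by (auto simp: iid_sample_def)
  have "S.indep_vars (\<lambda>_. P) (\<lambda>i \<omega>. (X i \<omega>, Y i \<omega>)) {1..n}"
    using ind unfolding S.indep_vars_def2 assms(4) measurable_cong_sets[OF refl assms(4)] .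
  moreover have "distr \<Omega> P (\<lambda>\<omega>. (X i \<omega>, Y i \<omega>)) = P" if "i \<in> {1..n}" for i
    using law[OF that] distr_cong[OF refl assms(4), of \<Omega> "\<lambda>\<omega>. (X i \<omega>, Y i \<omega>)" "\<lambda>\<omega>. (X i \<omega>, Y i \<omega>)"] by simp
  ultimately show ?thesis using assms(2) by unfold_locales auto
qed

theorem theorem5p7:
  fixes MX :: "'x measure" and MY :: "'y measure" and P :: "('x \<times> 'y) measure"
    and loss :: "('x \<Rightarrow> real) \<Rightarrow> 'x \<Rightarrow> 'y \<Rightarrow> real"
    and f0 :: "'x \<Rightarrow> real" and U :: "'x \<Rightarrow> 'y \<Rightarrow> real"
    and m \<kappa> c1 c2 M \<gamma> C0 U0 a0 s C1 :: real
  assumes P: "prob_space P" "sets P = sets (MX \<Otimes>\<^sub>M MY)"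
    and loss_convex: "convex_loss MX MY loss"
    and f0_minimizer:
      "is_arg_min (risk P loss) (\<lambda>f. f \<in> borel_measurable MX \<and> finite_risk P loss f) f0"
    and U: "(\<lambda>z. U (fst z) (snd z)) \<in> borel_measurable (MX \<Otimes>\<^sub>M MY)"
      "\<And>x y. x \<in> space MX \<Longrightarrow> y \<in> space MY \<Longrightarrow> 0 \<le> U x y"
    and A2: "1 < m" "min m 2 = 1 + \<kappa>" "0 < \<kappa>" "\<kappa> \<le> 1"
      "integrable P (\<lambda>z. U (fst z) (snd z) powr m)"
      "esssup P (\<lambda>z. ereal \<bar>real_cond_exp P (vimage_algebra (space P) fst MX)
          (\<lambda>z. U (fst z) (snd z) powr (1 + \<kappa>)) z\<bar>) < \<infinity>"
    and A3_consts: "0 < c1" "c1 \<le> c2"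
    and B1_const: "0 < M"
    and B2_consts: "0 \<le> \<gamma>" "0 < C0" "1 \<le> U0" "0 \<le> a0"
    and B3_const: "0 \<le> s" "s \<le> 1"
  shows "\<exists>C>0. \<exists>a\<ge>0. \<forall>(n::nat) (F :: ('x \<Rightarrow> real) set) (D::real)
      (\<Omega> :: 'w measure) (X :: nat \<Rightarrow> 'w \<Rightarrow> 'x) (Y :: nat \<Rightarrow> 'w \<Rightarrow> 'y) (fhat :: 'w \<Rightarrow> 'x \<Rightarrow> real).
    1 \<le> n \<longrightarrow>
    iid_sample \<Omega> MX MY P n X Y \<longrightarrow>
    F \<subseteq> borel_measurable MX \<longrightarrow>
    \<comment> \<open>(A1)\<close>
    (\<forall>f\<in>F. \<forall>g\<in>F. \<forall>x\<in>space MX. \<forall>y\<in>space MY.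
       \<bar>loss f x y - loss g x y\<bar> \<le> U x y * \<bar>f x - g x\<bar>) \<longrightarrow>
    \<comment> \<open>(A3)\<close>
    (\<forall>f\<in>F. finite_risk P loss f \<and>
       c1 * (L2_norm_fst P (\<lambda>x. f x - f0 x))\<^sup>2 \<le> risk P loss f - risk P loss f0 \<and>
       risk P loss f - risk P loss f0 \<le> c2 * (L2_norm_fst P (\<lambda>x. f x - f0 x))\<^sup>2) \<longrightarrow>
    \<comment> \<open>(B1)\<close>
    (\<forall>f\<in>F \<union> {f0}. \<forall>x\<in>space MX. \<bar>f x\<bar> \<le> M) \<longrightarrow>
    \<comment> \<open>(B2)\<close>
    1 \<le> D \<longrightarrow>
    (\<forall>h>0. log_covering_le h F (unif_dist (space MX))
       (C0 * D * h powr (- \<gamma>) * log_plus (U0 / h) powr a0)) \<longrightarrow>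
    \<comment> \<open>(B3)\<close>
    (\<forall>fs\<in>F. \<forall>G. G \<noteq> {} \<longrightarrow> G \<subseteq> (\<lambda>f x. f x - fs x) ` F \<longrightarrow>
       unif_norm (space MX) (envelope G) \<le> C1 * rpow (SUP g\<in>G. L2_norm_fst P g) s) \<longrightarrow>
    (\<forall>\<omega>\<in>space \<Omega>. is_arg_min (\<lambda>f. \<Sum>i=1..n. loss f (X i \<omega>) (Y i \<omega>)) (\<lambda>f. f \<in> F) (fhat \<omega>)) \<longrightarrow>
    (\<lambda>\<omega>. L2_norm_fst P (\<lambda>x. fhat \<omega> x - f0 x)) \<in> borel_measurable \<Omega> \<longrightarrow>
    (\<integral>\<omega>. L2_norm_fst P (\<lambda>x. fhat \<omega> x - f0 x) \<partial>\<Omega>)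
      \<le> C * log_plus (real n) powr a *
         ((real n / D) powr (- entropy_exponent \<gamma>)
          + (real n / D) powr (- inverse ((2 - s) / (1 - 1 / m) + s * \<gamma>))
          + (INF f\<in>F. L2_norm_fst P (\<lambda>x. f x - f0 x)))"
proof -
  define v where "v z = U (fst z) (snd z)" for z
  have space_P: "space P = space MX \<times> space MY"
    using sets_eq_imp_space_eq[OF P(2)] by (simp add: space_pair_measure)
  have v: "v \<in> borel_measurable P" "\<And>z. z \<in> space P \<Longrightarrow> 0 \<le> v z" "integrable P (\<lambda>z. v z powr m)"
    using U A2(5) measurable_cong_sets[OF P(2) refl] by (auto simp: v_def[abs_def] space_P)
  have "\<exists>\<sigma>. 2 \<le> m \<longrightarrow> (AE z in P. \<bar>real_cond_exp P (vimage_algebra (space P) fst MX) (\<lambda>z. (v z)\<^sup>2) z\<bar> \<le> \<sigma>)"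
  proof (cases "2 \<le> m")
    case True
    then have "1 + \<kappa> = 2" using A2(2) by simp
    then show ?thesis using conditional_square_bounded[OF P v(1,2)] A2(6) by (simp add: v_def)
  qed simp
  then obtain \<sigma> where \<sigma>: "2 \<le> m \<Longrightarrow> AE z in P. \<bar>real_cond_exp P (vimage_algebra (space P) fst MX) (\<lambda>z. (v z)\<^sup>2) z\<bar> \<le> \<sigma>"
    by blast
  define \<tau> where "\<tau> = max (max 1 \<sigma>) (max (\<integral>z. v z powr m \<partial>P) (\<integral>z. v z \<partial>P))"
  have \<tau>: "1 \<le> \<tau>" "(\<integral>z. v z powr m \<partial>P) \<le> \<tau>" "(\<integral>z. v z \<partial>P) \<le> \<tau>" by (auto simp: \<tau>_def)
  have v_cond: "AE z in P. \<bar>real_cond_exp P (vimage_algebra (space P) fst MX) (\<lambda>z. (v z)\<^sup>2) z\<bar> \<le> \<tau>" if "2 \<le> m"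
    using \<sigma>[OF that] by eventually_elim (auto simp: \<tau>_def)
  define A where "A = max C1 1"
  define c\<Lambda> where "c\<Lambda> = 2 * (2 * M + 1) powr \<gamma> + 2 * (C0 * 2 powr \<gamma> * (1 + ln (2 * U0)) powr a0)"
  define cJ where "cJ = 2 * ln (2 * M + 1) + 4"
  define K0 where "K0 = 2 * (2 + 2 * (2 * c2 / c1 + 2))"
  define K1 where "K1 = 8 / c1 * (38 * \<tau> * c\<Lambda> * A * cJ\<^sup>2)"
  define C where "C = K0 + K1 + 2 * M"
  have pos: "0 < K0" "0 \<le> K1" "0 \<le> c\<Lambda>" "1 \<le> A" "0 \<le> cJ"
    using A3_consts \<tau>(1) B1_const B2_consts
    by (auto simp: K0_def K1_def c\<Lambda>_def A_def cJ_def intro!: add_pos_nonneg mult_nonneg_nonneg add_nonneg_nonneg)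
  have f0: "f0 \<in> borel_measurable MX" using f0_minimizer by (simp add: is_arg_min_def)
  have bound: "(\<integral>\<omega>. L2_norm_fst P (\<lambda>x. fhat \<omega> x - f0 x) \<partial>\<Omega>)
      \<le> C * log_plus (real n) powr (2 + a0) *
         ((real n / D) powr (- entropy_exponent \<gamma>)
          + (real n / D) powr (- inverse ((2 - s) / (1 - 1 / m) + s * \<gamma>))
          + (INF f\<in>F. L2_norm_fst P (\<lambda>x. f x - f0 x)))"
    if n: "1 \<le> n" and iid: "iid_sample \<Omega> MX MY P n X Y" and F: "F \<subseteq> borel_measurable MX"
      and A1: "\<forall>f\<in>F. \<forall>g\<in>F. \<forall>x\<in>space MX. \<forall>y\<in>space MY. \<bar>loss f x y - loss g x y\<bar> \<le> U x y * \<bar>f x - g x\<bar>"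
      and A3: "\<forall>f\<in>F. finite_risk P loss f \<and>
       c1 * (L2_norm_fst P (\<lambda>x. f x - f0 x))\<^sup>2 \<le> risk P loss f - risk P loss f0 \<and>
       risk P loss f - risk P loss f0 \<le> c2 * (L2_norm_fst P (\<lambda>x. f x - f0 x))\<^sup>2"
      and B1: "\<forall>f\<in>F \<union> {f0}. \<forall>x\<in>space MX. \<bar>f x\<bar> \<le> M" and D: "1 \<le> D"
      and B2: "\<forall>h>0. log_covering_le h F (unif_dist (space MX))
       (C0 * D * h powr (- \<gamma>) * log_plus (U0 / h) powr a0)"
      and B3: "\<forall>fs\<in>F. \<forall>G. G \<noteq> {} \<longrightarrow> G \<subseteq> (\<lambda>f x. f x - fs x) ` F \<longrightarrow>
       unif_norm (space MX) (envelope G) \<le> C1 * rpow (SUP g\<in>G. L2_norm_fst P g) s"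
      and erm: "\<forall>\<omega>\<in>space \<Omega>. is_arg_min (\<lambda>f. \<Sum>i=1..n. loss f (X i \<omega>) (Y i \<omega>)) (\<lambda>f. f \<in> F) (fhat \<omega>)"
    for n :: nat and F :: "('x \<Rightarrow> real) set" and D :: real and \<Omega> :: "'w measure"
      and X :: "nat \<Rightarrow> 'w \<Rightarrow> 'x" and Y :: "nat \<Rightarrow> 'w \<Rightarrow> 'y" and fhat :: "'w \<Rightarrow> 'x \<Rightarrow> real"
  proof -
    let ?t = "real n / D"
    let ?e1 = "?t powr (- entropy_exponent \<gamma>)"
    let ?e2 = "?t powr (- inverse ((2 - s) / (1 - 1 / m) + s * \<gamma>))"
    let ?inf = "INF f\<in>F. L2_norm_fst P (\<lambda>x. f x - f0 x)"
    define \<L> where "\<L> f z = loss f (fst z) (snd z)" for f z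
    interpret iid_draws \<Omega> P n "\<lambda>i \<omega>. (X i \<omega>, Y i \<omega>)"
      by (rule iid_sample_imp_iid_draws[OF iid n P])
    interpret lipschitz_losses \<Omega> P n "\<lambda>i \<omega>. (X i \<omega>, Y i \<omega>)" MX MY \<L> F v m \<tau> M
    proof unfold_locales
      show "sets P = sets (MX \<Otimes>\<^sub>M MY)" by (rule P(2))
      show "f \<in> borel_measurable MX" if "f \<in> F" for f using F that by blast
      show "\<bar>f x\<bar> \<le> M" if "f \<in> F" "x \<in> space MX" for f x using B1 that by blast
      show "integrable P (\<L> f)" if "f \<in> F" for f
        using A3 that by (simp add: finite_risk_def \<L>_def[abs_def])
      show "\<bar>\<L> f z - \<L> g z\<bar> \<le> v z * \<bar>f (fst z) - g (fst z)\<bar>" if "f \<in> F" "g \<in> F" "z \<in> space P" for f g z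
        using A1 that unfolding \<L>_def v_def space_P by (auto simp: mem_Times_iff)
    qed (fact v \<tau> v_cond A2(1))+
    have fhat_F: "fhat \<omega> \<in> F" if "\<omega> \<in> space \<Omega>" for \<omega> using erm that by (auto simp: is_arg_min_def)
    have F_ne: "F \<noteq> {}" using S.not_empty fhat_F by blast
    have inf0: "0 \<le> ?inf" using F_ne L2_nonneg by (intro cINF_greatest) auto
    have lp: "1 \<le> log_plus (real n) powr p" if "0 \<le> p" for p
      using log_plus_ge_1 that by (simp add: ge_one_powr_ge_zero)
    define e where "e = ?e1 + ?e2 + ?inf"
    have e_ge: "?e1 \<le> e" "?e2 \<le> e" "0 \<le> e" using inf0 by (auto simp: e_def)
    show ?thesis
      \<comment> \<open>For \<open>D > n\<close> the first rate is at least \<open>1\<close>, and the uniform bound \<open>2 * M\<close> on the error suffices.\<close>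
    proof (cases "D \<le> real n")
      case False
      have L2M: "L2_norm_fst P (\<lambda>x. fhat \<omega> x - f0 x) \<le> 2 * M" if "\<omega> \<in> space \<Omega>" for \<omega>
      proof (rule L2_le_sup)
        fix x assume "x \<in> space MX"
        then have "\<bar>fhat \<omega> x\<bar> \<le> M" "\<bar>f0 x\<bar> \<le> M" using B1 fhat_F[OF that] by auto
        then show "\<bar>fhat \<omega> x - f0 x\<bar> \<le> 2 * M" by linarith
      qed (use B1_const in simp)
      have "(\<integral>\<omega>. L2_norm_fst P (\<lambda>x. fhat \<omega> x - f0 x) \<partial>\<Omega>) \<le> (\<integral>\<omega>. 2 * M \<partial>\<Omega>)"
        by (rule integral_mono') (use L2M B1_const in auto)
      also have "\<dots> = 2 * M * 1 * 1" by (simp add: S.prob_space)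
      also have "\<dots> \<le> C * log_plus (real n) powr (2 + a0) * e"
      proof (intro mult_mono)
        have "0 \<le> entropy_exponent \<gamma>" using B2_consts by (auto simp: entropy_exponent_def)
        moreover have "0 < ?t" "?t \<le> 1" using n D False by auto
        ultimately have "1 powr (- entropy_exponent \<gamma>) \<le> ?e1" by (intro powr_mono2') auto
        then show "1 \<le> e" using e_ge by simp
      qed (use pos B1_const B2_consts lp in \<open>auto simp: C_def\<close>)
      finally show ?thesis unfolding e_def .
    next
      case True
      have t: "1 \<le> ?t" using True D by simp
      note prod = finest_scale_le_product[OF t B2_consts(1) e_ge(1) order_refl]
      \<comment> \<open>The infimum need not be attained; an excess of one further rate term is harmless.\<close>
      have "?inf < ?inf + ?e1" using n D by simp
      then obtain fs where fs: "fs \<in> F" "L2_norm_fst P (\<lambda>x. fs x - f0 x) < ?inf + ?e1"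
        using cINF_less_iff[OF F_ne bdd_belowI2[OF L2_nonneg], of "\<lambda>f x. f x - f0 x"] by blast
      obtain J :: nat where J: "2 * M * real n \<le> 2 ^ J" "real J + 1 \<le> cJ * log_plus (real n)"
        using dyadic_depth[of "2 * M" n] B1_const n unfolding cJ_def by auto
      define \<Lambda> where "\<Lambda> = c\<Lambda> * log_plus (real n) powr a0"
      define b where "b = 38 * \<tau> * \<Lambda> * A * (real J + 1)"
      have local: "mean_sup_dev_le ((\<lambda>f z. \<L> f z - \<L> fs z) ` {f \<in> F. L2_norm_fst P (\<lambda>x. f x - fs x) \<le> \<delta>}) (b * (\<delta> * e))"
        if "e \<le> \<delta>" for \<delta>
        unfolding b_def
      proof (rule mean_sup_dev_le_local[OF fs(1) B1_const D True B2_consts(1) B3_const B2_consts(2-4) pos(4) e_ge(1,2) that _ _ J(1)])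
        show "\<bar>f x - fs x\<bar> \<le> A * rpow (L2_norm_fst P (\<lambda>x. f x - fs x)) s" if "f \<in> F" "x \<in> space MX" for f x
          unfolding A_def using B3 fs(1) F_bounded that by (intro sup_le_L2_power[where F = F and S = "space MX"]) auto
      qed (use B2 in \<open>auto simp: \<Lambda>_def c\<Lambda>_def\<close>)
      have "(\<integral>\<omega>. L2_norm_fst P (\<lambda>x. fhat \<omega> x - f0 x) \<partial>\<Omega>) \<le> (K0 + 8 / c1 * ((real J + 1) * b)) * e"
        unfolding K0_def
      proof (rule empirical_minimizer_L2_error[where fs = fs and \<rho> = "risk P loss f0"])
        have "0 \<le> ?e2" by simp
        then show "L2_norm_fst P (\<lambda>x. fs x - f0 x) \<le> e" using fs(2) unfolding e_def by linarith
        show "(\<Sum>i=1..n. \<L> (fhat \<omega>) (X i \<omega>, Y i \<omega>)) \<le> (\<Sum>i=1..n. \<L> f (X i \<omega>, Y i \<omega>))"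
          if "\<omega> \<in> space \<Omega>" "f \<in> F" for \<omega> f
          using erm that by (auto simp: is_arg_min_def \<L>_def not_less)
        have "1 / real n \<le> 1 / ?t" using t D n by (intro divide_left_mono) (auto simp: field_simps)
        then have "2 * M * real n * (1 / real n) \<le> 2 ^ J * e"
          using J(1) prod(2) n by (intro mult_mono) auto
        then show "2 * M \<le> 2 ^ J * e" using n by simp
      qed (use f0 B1 B1_const A3_consts A3 fhat_F fs(1) prod local in \<open>auto simp: \<L>_def risk_def\<close>)
      also have "K0 + 8 / c1 * ((real J + 1) * b) \<le> C * log_plus (real n) powr (2 + a0)"
      proof -
        let ?l = "log_plus (real n)"
        have l: "1 \<le> ?l" by (rule log_plus_ge_1)
        have "(real J + 1) * b = 38 * \<tau> * \<Lambda> * A * (real J + 1)\<^sup>2" by (simp add: b_def power2_eq_square)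
        also have "\<dots> \<le> 38 * \<tau> * \<Lambda> * A * (cJ * ?l)\<^sup>2"
          using J(2) \<tau>(1) pos l by (intro mult_left_mono power_mono) (auto simp: \<Lambda>_def)
        also have "\<dots> = 38 * \<tau> * c\<Lambda> * A * cJ\<^sup>2 * (?l powr 2 * ?l powr a0)"
          using l by (simp add: \<Lambda>_def power_mult_distrib)
        also have "?l powr 2 * ?l powr a0 = ?l powr (2 + a0)" by (simp add: powr_add)
        finally have "8 / c1 * ((real J + 1) * b) \<le> 8 / c1 * (38 * \<tau> * c\<Lambda> * A * cJ\<^sup>2 * ?l powr (2 + a0))"
          using A3_consts by (intro mult_left_mono) auto
        also have "\<dots> = K1 * ?l powr (2 + a0)" by (simp add: K1_def)
        finally have 1: "8 / c1 * ((real J + 1) * b) \<le> K1 * ?l powr (2 + a0)" .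
        have "K0 * 1 \<le> K0 * ?l powr (2 + a0)" using pos B2_consts lp by (intro mult_left_mono) auto
        moreover have "0 \<le> 2 * M * ?l powr (2 + a0)" using B1_const by simp
        ultimately show ?thesis using 1 unfolding C_def distrib_right by linarith
      qed
      finally have "(\<integral>\<omega>. L2_norm_fst P (\<lambda>x. fhat \<omega> x - f0 x) \<partial>\<Omega>) \<le> C * log_plus (real n) powr (2 + a0) * e"
        using e_ge(3) by (simp add: mult_right_mono)
      then show ?thesis unfolding e_def .
    qed
  qed
  have C0: "0 < C" using pos B1_const by (simp add: C_def)
  have a0: "0 \<le> 2 + a0" using B2_consts by simp
  show ?thesis
  proof (rule exI[of _ C], rule conjI[OF C0], rule exI[of _ "2 + a0"], rule conjI[OF a0], intro allI impI)
  qed (rule bound)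
qed

end
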